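(* Let $f\in\mathfrak{LC}$ be a Lipschitz Carathéodory map. Then, given any $z_0\in X$, there exist $r,\delta>0$ such that, for every $z\in X$ with $\|z-z_0\|\le r$, the abstract Cauchy problem $u'(t)=A\,u(t)+\tilde f(t,u(t))$, $t>0$, $u(0)=z$, has a unique mild solution $u$ in the space $C([0,\delta],X)$.
   Context: Setting. $M,N\ge 1$; $U\subset\mathbb R^M$ is a bounded, open, connected set with sufficiently smooth boundary; $|y|=|y_1|+\dots+|y_N|$ on $\mathbb R^N$; $L^1_{loc}$ is the space of locally integrable functions $\mathbb R\to\mathbb R$. One fixes Neumann, Robin or Dirichlet boundary conditions: for $1\le i\le N$, $\alpha_i(x)y_i+\kappa\,\partial y_i/\partial n=0$ on $\partial U$, with $\kappa=0,\alpha_i\equiv1$ (Dirichlet), $\kappa=1,\alpha_i\equiv 0$ (Neumann), or $\kappa=1$ and $\alpha_i:\partial U\to\mathbb R$ nonnegative and sufficiently regular (Robin). Put $Y=C(\overline U)$, $X=C(\overline U,\mathbb R^N)$ in the Neumann/Robin case, and $Y=C_0(\overline U)$, $X=C_0(\overline U,\mathbb R^N)$ (continuous functions on $\overline U$ vanishing on $\partial U$) in the Dirichlet case. $X$ has the norm $\|z\|=\sup_{x\in\overline U}|z(x)|$. Semigroup. $A_i$ is the closure in $Y$ of $A_i^0z_i=\Delta z_i$ with domain $\{z_i\in C^2(U)\cap C^1(\overline U): \Delta z_i\in C(\overline U),\ \alpha_i z_i+\partial z_i/\partial n=0 \text{ on }\partial U\}$ (Neumann/Robin), resp. $\{z_i\in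 C^2(U)\cap C_0(\overline U):\Delta z_i\in C_0(\overline U)\}$ (Dirichlet). It is a known fact (the regularity of $\partial U$ and $\alpha_i$ is assumed sufficient for it) that $A_i$ is sectorial and generates a strongly continuous analytic semigroup $(e^{tA_i})_{t\ge0}$ on $Y$, with $e^{tA_i}$ compact for $t>0$ and $\|e^{tA_i}\|\le1$. Then $A=\prod_{i=1}^N A_i$ on $X=Y^N$ and $e^{tA}=\prod_i e^{tA_i}$; for the operator norm associated to $\|\cdot\|$, $\|e^{tA}\|\le N$ for all $t\ge0$. Carathéodory maps. $f:\mathbb R\times\overline U\times\mathbb R^N\to\mathbb R^N$ is in $\mathfrak{SC}$ if it is Borel measurable; for every compact $K\subset\mathbb R^N$ there is a nonnegative $m^K\in L^1_{loc}$ with, for a.e. $t$, $|f(t,x,y)|\le m^K(t)$ for all $x\in\overline U$, $y\in K$; and for a.e. $t$ the map $f(t,\cdot,\cdot)$ is continuous. $f\in\mathfrak{LC}$ if moreover for every compact $K\subset\mathbb R^N$ there is a nonnegative $l^K\in L^1_{loc}$ such that for a.e. $t$, $|f(t,x,y_1)-f(t,x,y_2)|\le l^K(t)|y_1-y_2|$ for all $x\in\overline U$, $y_1,y_2\in K$. In the Dirichlet case it is a standing assumption that $f(t,x,0)=0$ for all $t\in\mathbb R$, $x\in\partial U$. Set $\tilde f(t,z)(x)=f(t,x,z(x))$ for $x\in\overline U$. Mild solution. $u\in C([0,\delta],X)$ is a mild solution on $[0,\delta]$ if $u(0)=z$ and $u(t)=e^{tA}u(0)+\int_0^t e^{(t-s)A}\tilde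 f(s,u(s))\,ds$ for all $t\in[0,\delta]$ (Bochner integral). *)

theory Defs
  imports "HOL-Analysis.Analysis"
begin

section \<open>Spaces of continuous functions\<close>

text \<open>
  The parameter \<open>\<kappa>\<close> is the coefficient of the normal derivative in the boundary condition
  \<open>\<alpha>\<^sub>i y\<^sub>i + \<kappa> \<partial>y\<^sub>i/\<partial>n = 0\<close>; the Dirichlet case is \<open>\<kappa> = 0\<close>.
  A continuous function on \<open>closure U\<close> is represented by its extension by \<open>0\<close> to the whole space,
  so that equality of functions is equality on \<open>closure U\<close>.
  With real, vector and complex values, \<open>cont_space\<close> is respectively \<open>Y\<close>, \<open>X\<close> and the
  complexification of \<open>Y\<close>.
\<close>

definition cont_space :: "real \<Rightarrow> (real^'m) set \<Rightarrow> (real^'m \<Rightarrow> 'b::real_normed_vector) set" where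
  "cont_space \<kappa> U = {z. continuous_on (closure U) z \<and> (\<forall>x. x \<notin> closure U \<longrightarrow> z x = 0) \<and>
     (\<kappa> = 0 \<longrightarrow> (\<forall>x\<in>frontier U. z x = 0))}"

definition sup_norm :: "(real^'m) set \<Rightarrow> (real^'m \<Rightarrow> 'b::real_normed_vector) \<Rightarrow> real" where
  "sup_norm U z = (SUP x\<in>closure U. norm (z x))"

definition norm1 :: "real^'n \<Rightarrow> real" where
  "norm1 y = (\<Sum>i\<in>UNIV. \<bar>y $ i\<bar>)"

text \<open>The norm of \<open>X\<close>, built on \<open>norm1\<close> and not on the Euclidean norm of \<^typ>\<open>real^'n\<close>.\<close>

definition X_norm :: "(real^'m) set \<Rightarrow> (real^'m \<Rightarrow> real^'n) \<Rightarrow> real" where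
  "X_norm U z = (SUP x\<in>closure U. norm1 (z x))"

section \<open>Domains, boundary conditions and the Laplacian\<close>

definition partial :: "'m \<Rightarrow> (real^'m \<Rightarrow> real) \<Rightarrow> real^'m \<Rightarrow> real" where
  "partial j z x = frechet_derivative z (at x) (axis j 1)"

definition grad :: "(real^'m \<Rightarrow> real) \<Rightarrow> real^'m \<Rightarrow> real^'m" where
  "grad z x = (\<chi> j. partial j z x)"

definition C1_on :: "(real^'m) set \<Rightarrow> (real^'m \<Rightarrow> real) \<Rightarrow> bool" where
  "C1_on S z \<longleftrightarrow> (\<forall>x\<in>S. z differentiable (at x)) \<and> continuous_on S (grad z)"

definition C2_on :: "(real^'m) set \<Rightarrow> (real^'m \<Rightarrow> real) \<Rightarrow> bool" where
  "C2_on S z \<longleftrightarrow> C1_on S z \<and> (\<forall>j. C1_on S (partial j z))"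

definition laplacian :: "(real^'m \<Rightarrow> real) \<Rightarrow> real^'m \<Rightarrow> real" where
  "laplacian z x = (\<Sum>j\<in>UNIV. partial j (partial j z) x)"

definition boundary_chart :: "(real^'m) set \<Rightarrow> real^'m \<Rightarrow> (real^'m) set \<Rightarrow> (real^'m \<Rightarrow> real) \<Rightarrow> bool" where
  "boundary_chart U p W \<phi> \<longleftrightarrow> open W \<and> p \<in> W \<and> C1_on W \<phi> \<and> (\<forall>x\<in>W. grad \<phi> x \<noteq> 0) \<and>
     U \<inter> W = {x\<in>W. \<phi> x < 0} \<and> frontier U \<inter> W = {x\<in>W. \<phi> x = 0}"

definition C1_boundary :: "(real^'m) set \<Rightarrow> bool" where
  "C1_boundary U \<longleftrightarrow> (\<forall>p\<in>frontier U. \<exists>W \<phi>. boundary_chart U p W \<phi>)"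

definition outer_normal :: "(real^'m) set \<Rightarrow> real^'m \<Rightarrow> real^'m" where
  "outer_normal U p =
     (THE \<nu>. \<exists>W \<phi>. boundary_chart U p W \<phi> \<and> \<nu> = grad \<phi> p /\<^sub>R norm (grad \<phi> p))"

text \<open>
  Dirichlet, Neumann and Robin coefficients, in this order. The same type of condition is imposed
  on all components.
\<close>

definition boundary_coefficients :: "(real^'m) set \<Rightarrow> real \<Rightarrow> ('n \<Rightarrow> real^'m \<Rightarrow> real) \<Rightarrow> bool" where
  "boundary_coefficients U \<kappa> \<alpha> \<longleftrightarrow>
     (\<kappa> = 0 \<and> (\<forall>i. \<forall>x\<in>frontier U. \<alpha> i x = 1)) \<or>
     (\<kappa> = 1 \<and> (\<forall>i. \<forall>x\<in>frontier U. \<alpha> i x = 0)) \<or>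
     (\<kappa> = 1 \<and> (\<forall>i. continuous_on (frontier U) (\<alpha> i) \<and> (\<forall>x\<in>frontier U. \<alpha> i x \<ge> 0)))"

text \<open>
  Unbounded operators are given by their graphs. In \<open>laplace0\<close>, the function \<open>w\<close> is the
  continuous extension of the Laplacian of \<open>z\<close> to \<open>closure U\<close>, and \<open>g\<close> that of the gradient
  of \<open>z\<close>; the existence of \<open>g\<close> expresses that \<open>z\<close> is in \<open>C\<^sup>1\<close> up to the boundary.
\<close>

definition laplace0 ::
  "real \<Rightarrow> (real^'m) set \<Rightarrow> (real^'m \<Rightarrow> real) \<Rightarrow> ((real^'m \<Rightarrow> real) \<times> (real^'m \<Rightarrow> real)) set" where
  "laplace0 \<kappa> U a = {(z, w). z \<in> cont_space \<kappa> U \<and> w \<in> cont_space \<kappa> U \<and> C2_on U z \<and>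
     (\<forall>x\<in>U. w x = laplacian z x) \<and>
     (\<kappa> \<noteq> 0 \<longrightarrow> (\<exists>g. continuous_on (closure U) g \<and> (\<forall>x\<in>U. g x = grad z x) \<and>
        (\<forall>x\<in>frontier U. a x * z x + \<kappa> * (g x \<bullet> outer_normal U x) = 0)))}"

definition graph_closure ::
  "real \<Rightarrow> (real^'m) set \<Rightarrow> ((real^'m \<Rightarrow> real) \<times> (real^'m \<Rightarrow> real)) set
     \<Rightarrow> ((real^'m \<Rightarrow> real) \<times> (real^'m \<Rightarrow> real)) set" where
  "graph_closure \<kappa> U G = {(z, w). z \<in> cont_space \<kappa> U \<and> w \<in> cont_space \<kappa> U \<and>
     (\<exists>zs ws. (\<forall>k::nat. (zs k, ws k) \<in> G) \<and>
        (\<lambda>k. sup_norm U (\<lambda>x. zs k x - z x)) \<longlonglongrightarrow> 0 \<and>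
        (\<lambda>k. sup_norm U (\<lambda>x. ws k x - w x)) \<longlonglongrightarrow> 0)}"

definition laplace ::
  "real \<Rightarrow> (real^'m) set \<Rightarrow> (real^'m \<Rightarrow> real) \<Rightarrow> ((real^'m \<Rightarrow> real) \<times> (real^'m \<Rightarrow> real)) set" where
  "laplace \<kappa> U a = graph_closure \<kappa> U (laplace0 \<kappa> U a)"

section \<open>Semigroups on \<open>Y\<close>\<close>

text \<open>Values of \<open>T t z\<close> for \<open>t < 0\<close> or \<open>z \<notin> Y\<close> are irrelevant.\<close>

definition C0_semigroup ::
  "real \<Rightarrow> (real^'m) set \<Rightarrow> (real \<Rightarrow> (real^'m \<Rightarrow> real) \<Rightarrow> (real^'m \<Rightarrow> real)) \<Rightarrow> bool" where
  "C0_semigroup \<kappa> U T \<longleftrightarrow>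
     (\<forall>t\<ge>0. \<forall>z\<in>cont_space \<kappa> U. T t z \<in> cont_space \<kappa> U) \<and>
     (\<forall>t\<ge>0. \<forall>z\<in>cont_space \<kappa> U. \<forall>w\<in>cont_space \<kappa> U. \<forall>a b.
        T t (\<lambda>x. a * z x + b * w x) = (\<lambda>x. a * T t z x + b * T t w x)) \<and>
     (\<forall>t\<ge>0. \<exists>C. \<forall>z\<in>cont_space \<kappa> U. sup_norm U (T t z) \<le> C * sup_norm U z) \<and>
     (\<forall>z\<in>cont_space \<kappa> U. T 0 z = z) \<and>
     (\<forall>s\<ge>0. \<forall>t\<ge>0. \<forall>z\<in>cont_space \<kappa> U. T (s + t) z = T s (T t z)) \<and>
     (\<forall>z\<in>cont_space \<kappa> U. ((\<lambda>t. sup_norm U (\<lambda>x. T t z x - z x)) \<longlongrightarrow> 0) (at_right 0))"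

definition generator ::
  "real \<Rightarrow> (real^'m) set \<Rightarrow> (real \<Rightarrow> (real^'m \<Rightarrow> real) \<Rightarrow> (real^'m \<Rightarrow> real))
     \<Rightarrow> ((real^'m \<Rightarrow> real) \<times> (real^'m \<Rightarrow> real)) set" where
  "generator \<kappa> U T = {(z, w). z \<in> cont_space \<kappa> U \<and> w \<in> cont_space \<kappa> U \<and>
     ((\<lambda>t. sup_norm U (\<lambda>x. (T t z x - z x) / t - w x)) \<longlongrightarrow> 0) (at_right 0)}"

definition complexify ::
  "((real^'m \<Rightarrow> real) \<times> (real^'m \<Rightarrow> real)) set \<Rightarrow> ((real^'m \<Rightarrow> complex) \<times> (real^'m \<Rightarrow> complex)) set" where
  "complexify G = {(z, w). (Re \<circ> z, Re \<circ> w) \<in> G \<and> (Im \<circ> z, Im \<circ> w) \<in> G}"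

definition sector :: "real \<Rightarrow> complex set" where
  "sector \<theta> = {\<zeta>. \<zeta> \<noteq> 0 \<and> \<bar>Arg \<zeta>\<bar> < \<theta>}"

text \<open>
  The pair \<open>(z, \<mu>z - w)\<close> lies in the graph of the operator \<open>A\<close> iff \<open>(\<mu> - A) z = w\<close>, that is,
  \<open>z = R(\<mu>, A) w\<close> when \<open>\<mu>\<close> is in the resolvent set.
\<close>

definition sectorial ::
  "real \<Rightarrow> (real^'m) set \<Rightarrow> ((real^'m \<Rightarrow> real) \<times> (real^'m \<Rightarrow> real)) set \<Rightarrow> bool" where
  "sectorial \<kappa> U G \<longleftrightarrow> (\<exists>\<omega>::real. \<exists>\<theta> M. pi / 2 < \<theta> \<and> \<theta> < pi \<and>
     (\<forall>\<mu>. \<mu> - of_real \<omega> \<in> sector \<theta> \<longrightarrow>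
        (\<forall>w\<in>cont_space \<kappa> U. \<exists>!z. (z, \<lambda>x. \<mu> * z x - w x) \<in> complexify G) \<and>
        (\<forall>w\<in>cont_space \<kappa> U. \<forall>z. (z, \<lambda>x. \<mu> * z x - w x) \<in> complexify G \<longrightarrow>
           sup_norm U z \<le> M / cmod (\<mu> - of_real \<omega>) * sup_norm U w)))"

text \<open>\<open>S\<close> is a holomorphic extension of \<open>T\<close> to a sector, acting on the complexification of \<open>Y\<close>.\<close>

definition analytic_semigroup ::
  "real \<Rightarrow> (real^'m) set \<Rightarrow> (real \<Rightarrow> (real^'m \<Rightarrow> real) \<Rightarrow> (real^'m \<Rightarrow> real)) \<Rightarrow> bool" where
  "analytic_semigroup \<kappa> U T \<longleftrightarrow> (\<exists>\<theta> (S :: complex \<Rightarrow> (real^'m \<Rightarrow> complex) \<Rightarrow> (real^'m \<Rightarrow> complex)).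
     0 < \<theta> \<and> \<theta> \<le> pi / 2 \<and>
     (\<forall>\<zeta>\<in>sector \<theta>. \<forall>z\<in>cont_space \<kappa> U. S \<zeta> z \<in> cont_space \<kappa> U) \<and>
     (\<forall>\<zeta>\<in>sector \<theta>. \<forall>z\<in>cont_space \<kappa> U. \<forall>w\<in>cont_space \<kappa> U. \<forall>a b.
        S \<zeta> (\<lambda>x. a * z x + b * w x) = (\<lambda>x. a * S \<zeta> z x + b * S \<zeta> w x)) \<and>
     (\<forall>\<zeta>\<in>sector \<theta>. \<exists>C. \<forall>z\<in>cont_space \<kappa> U. sup_norm U (S \<zeta> z) \<le> C * sup_norm U z) \<and>
     (\<forall>t>0. \<forall>z\<in>cont_space \<kappa> U.
        S (of_real t) (\<lambda>x. complex_of_real (z x)) = (\<lambda>x. complex_of_real (T t z x))) \<and>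
     (\<forall>\<zeta>\<in>sector \<theta>. \<forall>\<eta>\<in>sector \<theta>. \<forall>z\<in>cont_space \<kappa> U. S (\<zeta> + \<eta>) z = S \<zeta> (S \<eta> z)) \<and>
     (\<forall>\<zeta>\<in>sector \<theta>. \<forall>z\<in>cont_space \<kappa> U. \<exists>d\<in>cont_space \<kappa> U.
        ((\<lambda>\<eta>. sup_norm U (\<lambda>x. (S \<eta> z x - S \<zeta> z x) / (\<eta> - \<zeta>) - d x)) \<longlongrightarrow> 0) (at \<zeta>)) \<and>
     (\<forall>\<theta>'<\<theta>. \<forall>z\<in>cont_space \<kappa> U.
        ((\<lambda>\<zeta>. sup_norm U (\<lambda>x. S \<zeta> z x - z x)) \<longlongrightarrow> 0) (at 0 within sector \<theta>')))"

definition compact_operator ::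
  "real \<Rightarrow> (real^'m) set \<Rightarrow> ((real^'m \<Rightarrow> real) \<Rightarrow> (real^'m \<Rightarrow> real)) \<Rightarrow> bool" where
  "compact_operator \<kappa> U L \<longleftrightarrow>
     (\<forall>zs. (\<forall>k::nat. zs k \<in> cont_space \<kappa> U \<and> sup_norm U (zs k) \<le> 1) \<longrightarrow>
        (\<exists>r. \<exists>w\<in>cont_space \<kappa> U. strict_mono r \<and>
           (\<lambda>k. sup_norm U (\<lambda>x. L (zs (r k)) x - w x)) \<longlonglongrightarrow> 0))"

text \<open>
  \<open>T\<close> is the semigroup generated by the closure of the Laplacian, with the properties that the
  regularity of the boundary and of \<open>a\<close> is assumed to guarantee: together with \<open>C1_boundary\<close>
  and the continuity of the Robin coefficients, this predicate is the meaning of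
  ``sufficiently smooth''.
\<close>

definition laplace_semigroup ::
  "real \<Rightarrow> (real^'m) set \<Rightarrow> (real^'m \<Rightarrow> real)
     \<Rightarrow> (real \<Rightarrow> (real^'m \<Rightarrow> real) \<Rightarrow> (real^'m \<Rightarrow> real)) \<Rightarrow> bool" where
  "laplace_semigroup \<kappa> U a T \<longleftrightarrow>
     sectorial \<kappa> U (laplace \<kappa> U a) \<and>
     C0_semigroup \<kappa> U T \<and> generator \<kappa> U T = laplace \<kappa> U a \<and>
     analytic_semigroup \<kappa> U T \<and>
     (\<forall>t>0. compact_operator \<kappa> U (T t)) \<and>
     (\<forall>t\<ge>0. \<forall>z\<in>cont_space \<kappa> U. sup_norm U (T t z) \<le> sup_norm U z)"

definition product_semigroup ::
  "('n \<Rightarrow> real \<Rightarrow> (real^'m \<Rightarrow> real) \<Rightarrow> (real^'m \<Rightarrow> real))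
     \<Rightarrow> real \<Rightarrow> (real^'m \<Rightarrow> real^'n) \<Rightarrow> (real^'m \<Rightarrow> real^'n)" where
  "product_semigroup T t z = (\<lambda>x. \<chi> i. T i t (\<lambda>x'. z x' $ i) x)"

section \<open>Caratheodory maps\<close>

definition L1_loc :: "(real \<Rightarrow> real) \<Rightarrow> bool" where
  "L1_loc m \<longleftrightarrow> (\<forall>K. compact K \<longrightarrow> set_integrable lebesgue K m)"

definition strong_caratheodory :: "(real^'m) set \<Rightarrow> (real \<Rightarrow> real^'m \<Rightarrow> real^'n \<Rightarrow> real^'n) \<Rightarrow> bool" where
  "strong_caratheodory U f \<longleftrightarrow>
     (\<lambda>(t, x, y). f t x y) \<in> borel_measurable (restrict_space borel (UNIV \<times> closure U \<times> UNIV)) \<and>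
     (\<forall>K. compact K \<longrightarrow> (\<exists>m. L1_loc m \<and> (\<forall>t. 0 \<le> m t) \<and>
        (AE t in lebesgue. \<forall>x\<in>closure U. \<forall>y\<in>K. norm1 (f t x y) \<le> m t))) \<and>
     (AE t in lebesgue. continuous_on (closure U \<times> UNIV) (\<lambda>(x, y). f t x y))"

definition lipschitz_caratheodory :: "(real^'m) set \<Rightarrow> (real \<Rightarrow> real^'m \<Rightarrow> real^'n \<Rightarrow> real^'n) \<Rightarrow> bool" where
  "lipschitz_caratheodory U f \<longleftrightarrow> strong_caratheodory U f \<and>
     (\<forall>K. compact K \<longrightarrow> (\<exists>l. L1_loc l \<and> (\<forall>t. 0 \<le> l t) \<and>
        (AE t in lebesgue. \<forall>x\<in>closure U. \<forall>y1\<in>K. \<forall>y2\<in>K.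
           norm1 (f t x y1 - f t x y2) \<le> l t * norm1 (y1 - y2))))"

definition nemytskii ::
  "(real^'m) set \<Rightarrow> (real \<Rightarrow> real^'m \<Rightarrow> real^'n \<Rightarrow> real^'n)
     \<Rightarrow> real \<Rightarrow> (real^'m \<Rightarrow> real^'n) \<Rightarrow> (real^'m \<Rightarrow> real^'n)" where
  "nemytskii U f t z = (\<lambda>x. if x \<in> closure U then f t x (z x) else 0)"

section \<open>Bochner integral in \<open>X\<close> and mild solutions\<close>

text \<open>
  The library's Bochner integral needs a second countable type of values, whereas \<open>X\<close> is a set
  depending on \<open>U\<close>; its definition through approximation by simple functions is therefore
  repeated for \<open>X\<close>. The integrand need only take values in \<open>X\<close> almost everywhere.
\<close>

definition step_integral :: "real set \<Rightarrow> (real \<Rightarrow> real^'m \<Rightarrow> real^'n) \<Rightarrow> real^'m \<Rightarrow> real^'n" where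
  "step_integral J s =
     (\<lambda>x. \<Sum>v\<in>s ` J. measure (lebesgue_on J) {\<tau>\<in>J. s \<tau> = v} *\<^sub>R v x)"

definition has_X_integral ::
  "real \<Rightarrow> (real^'m) set \<Rightarrow> real set \<Rightarrow> (real \<Rightarrow> real^'m \<Rightarrow> real^'n) \<Rightarrow> (real^'m \<Rightarrow> real^'n) \<Rightarrow> bool" where
  "has_X_integral \<kappa> U J F I \<longleftrightarrow> I \<in> cont_space \<kappa> U \<and>
     (AE \<tau> in lebesgue_on J. F \<tau> \<in> cont_space \<kappa> U) \<and>
     (\<exists>s. (\<forall>n::nat. simple_function (lebesgue_on J) (s n) \<and> s n ` J \<subseteq> cont_space \<kappa> U) \<and>
        (AE \<tau> in lebesgue_on J. (\<lambda>n. X_norm U (\<lambda>x. F \<tau> x - s n \<tau> x)) \<longlonglongrightarrow> 0) \<and>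
        (\<lambda>n. \<integral>\<^sup>+\<tau>. ennreal (X_norm U (\<lambda>x. F \<tau> x - s n \<tau> x)) \<partial>lebesgue_on J) \<longlonglongrightarrow> 0 \<and>
        (\<lambda>n. X_norm U (\<lambda>x. step_integral J (s n) x - I x)) \<longlonglongrightarrow> 0)"

text \<open>
  \<open>C([0,\<delta>], X)\<close>, with paths taken to be \<open>undefined\<close> outside \<open>[0,\<delta>]\<close> so that equality of
  paths is equality on \<open>[0,\<delta>]\<close>.
\<close>

definition path_space :: "real \<Rightarrow> (real^'m) set \<Rightarrow> real \<Rightarrow> (real \<Rightarrow> real^'m \<Rightarrow> real^'n) set" where
  "path_space \<kappa> U \<delta> = {u. u \<in> {0..\<delta>} \<rightarrow>\<^sub>E cont_space \<kappa> U \<and>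
     (\<forall>s\<in>{0..\<delta>}. ((\<lambda>t. X_norm U (\<lambda>x. u t x - u s x)) \<longlongrightarrow> 0) (at s within {0..\<delta>}))}"

definition mild_solution ::
  "real \<Rightarrow> (real^'m) set \<Rightarrow> ('n \<Rightarrow> real \<Rightarrow> (real^'m \<Rightarrow> real) \<Rightarrow> (real^'m \<Rightarrow> real))
     \<Rightarrow> (real \<Rightarrow> real^'m \<Rightarrow> real^'n \<Rightarrow> real^'n) \<Rightarrow> (real^'m \<Rightarrow> real^'n) \<Rightarrow> real
     \<Rightarrow> (real \<Rightarrow> real^'m \<Rightarrow> real^'n) \<Rightarrow> bool" where
  "mild_solution \<kappa> U T f z \<delta> u \<longleftrightarrow> u \<in> path_space \<kappa> U \<delta> \<and> u 0 = z \<and>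
     (\<forall>t\<in>{0..\<delta>}. \<exists>I.
        has_X_integral \<kappa> U {0..t}
          (\<lambda>s. product_semigroup T (t - s) (nemytskii U f s (u s))) I \<and>
        u t = (\<lambda>x. product_semigroup T t (u 0) x + I x))"

end

theory Submission
  imports Defs
begin

text \<open>
  Evaluation at a point turns the Bochner integral in \<open>X\<close> into a Lebesgue integral in
  \<^typ>\<open>real^'n\<close>; conversely, as \<open>X\<close> is separable, a dominated \<open>X\<close>-valued map is Bochner integrable as
  soon as its evaluations are measurable. The variation of constants formula can therefore be treated
  pointwise, and a path in \<open>X\<close> is the same as a jointly continuous function of time and space. On
  paths bounded by \<open>R\<close>, the right hand side of the formula is Lipschitz with constant \<open>C \<integral> l\<close>, where
  \<open>C\<close> bounds the semigroup and \<open>l\<close> is the Lipschitz coefficient of \<open>f\<close> on the ball of radius \<open>R\<close>,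
  up to a factor from the comparison of norms. This is at most
  \<open>1/2\<close> on short intervals, which gives existence by contraction on one such interval and uniqueness
  among all paths by steps of a fixed length.
\<close>

section \<open>The norms of \<open>X\<close> and \<open>Y\<close>\<close>

text \<open>Neither \<open>X\<close> nor the set of paths is a type, and the forcing lies in
  \<open>X\<close> only for almost every time. Estimates are therefore made at the points of
  \<open>closure U\<close>, in the Euclidean norm, and membership in \<open>X\<close> is recovered
  afterwards. As the coefficients in the hypotheses on \<open>f\<close> are only locally integrable,
  smallness on short intervals is absolute continuity of their integrals, not a bound times a
  length. Existence needs two small integrals: that of the growth bound keeps the iteration inside a
  ball of radius \<open>C * \<rho> + 1\<close>, that of the Lipschitz coefficient makes it contract.
  Here \<rho> bounds all initial values near \<open>z0\<close>, so one interval length serves all of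
  them. Uniqueness must also cover solutions that leave this ball. For two given solutions a ball
  containing both is taken, and its Lipschitz coefficient determines a new step length; that length
  may be smaller than the interval, hence the advance by steps.\<close>

lemma norm1_nonneg: "0 \<le> norm1 y"
  by (simp add: norm1_def sum_nonneg)

lemma norm1_zero [simp]: "norm1 0 = 0"
  by (simp add: norm1_def)

lemma norm_le_norm1: "norm y \<le> norm1 y"
  by (simp add: norm1_def norm_le_l1_cart)

lemma norm1_le_norm: "norm1 (y :: real^'n) \<le> real CARD('n) * norm y"
proof -
  have "norm1 y \<le> (\<Sum>i\<in>(UNIV :: 'n set). norm y)"
    unfolding norm1_def by (intro sum_mono component_le_norm_cart)
  then show ?thesis by simp
qed

lemma continuous_on_norm1 [continuous_intros]:
  "continuous_on S h \<Longrightarrow> continuous_on S (\<lambda>x. norm1 (h x))"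
  unfolding norm1_def by (intro continuous_intros)

lemma borel_measurable_norm1 [measurable (raw)]:
  "h \<in> borel_measurable M \<Longrightarrow> (\<lambda>x. norm1 (h x)) \<in> borel_measurable M"
  using borel_measurable_continuous_onI[OF continuous_on_norm1[OF continuous_on_id]]
  by (rule measurable_compose[rotated])

lemma X_norm_le:
  assumes "U \<noteq> {}" "\<And>x. x \<in> closure U \<Longrightarrow> norm1 (z x) \<le> c"
  shows "X_norm U z \<le> c"
  unfolding X_norm_def using assms by (intro cSUP_least) auto

text \<open>\<open>SUP\<close> over the reals says nothing unless the set is bounded above;
  compactness of \<open>closure U\<close> provides this.\<close>

lemma norm1_le_X_norm:
  assumes "bounded U" "z \<in> cont_space \<kappa> U" "x \<in> closure U"
  shows "norm1 (z x) \<le> X_norm U z"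
proof -
  have "compact ((\<lambda>x. norm1 (z x)) ` closure U)"
    using assms by (intro compact_continuous_image continuous_intros)
      (auto simp: cont_space_def compact_closure)
  then show ?thesis
    unfolding X_norm_def using assms(3)
    by (intro cSUP_upper) (auto intro: bounded_imp_bdd_above compact_imp_bounded)
qed

lemma norm_le_X_norm:
  assumes "bounded U" "z \<in> cont_space \<kappa> U" "x \<in> closure U"
  shows "norm (z x) \<le> X_norm U z"
  by (rule order_trans[OF norm_le_norm1 norm1_le_X_norm[OF assms]])

lemma X_norm_nonneg:
  assumes "U \<noteq> {}" "bounded U" "z \<in> cont_space \<kappa> U"
  shows "0 \<le> X_norm U z"
proof -
  from assms(1) obtain x where "x \<in> closure U" using closure_subset by blast
  from norm1_nonneg norm1_le_X_norm[OF assms(2,3) this] show ?thesis by (rule order_trans)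
qed

text \<open>The dimension factor is the price of estimating in the Euclidean norm while
  \<open>X\<close> carries \<open>norm1\<close>. The opposite direction,
  \<open>norm_le_X_norm\<close>, costs nothing.\<close>

lemma X_norm_le_norm:
  fixes z :: "real^'m \<Rightarrow> real^'n"
  assumes "U \<noteq> {}" "\<And>x. x \<in> closure U \<Longrightarrow> norm (z x) \<le> c"
  shows "X_norm U z \<le> real CARD('n) * c"
  by (rule X_norm_le[OF assms(1)], rule order_trans[OF norm1_le_norm mult_left_mono])
    (use assms(2) in auto)

lemma cont_space_zero [simp]: "(\<lambda>x. 0) \<in> cont_space \<kappa> U"
  by (simp add: cont_space_def)

lemma cont_space_diff:
  "z \<in> cont_space \<kappa> U \<Longrightarrow> w \<in> cont_space \<kappa> U \<Longrightarrow> (\<lambda>x. z x - w x) \<in> cont_space \<kappa> U"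
  by (auto simp: cont_space_def intro: continuous_intros)

lemma cont_space_add:
  "z \<in> cont_space \<kappa> U \<Longrightarrow> w \<in> cont_space \<kappa> U \<Longrightarrow> (\<lambda>x. z x + w x) \<in> cont_space \<kappa> U"
  by (auto simp: cont_space_def intro: continuous_intros)

lemma cont_space_component:
  "z \<in> cont_space \<kappa> U \<Longrightarrow> (\<lambda>x. z x $ i) \<in> cont_space \<kappa> U"
  by (auto simp: cont_space_def intro: continuous_intros)

lemma cont_space_vec_lambda:
  "(\<And>i. z i \<in> cont_space \<kappa> U) \<Longrightarrow> (\<lambda>x. \<chi> i. z i x) \<in> cont_space \<kappa> U"
  by (auto simp: cont_space_def vec_eq_iff intro: continuous_on_vec_lambda)

lemma sup_norm_le:
  assumes "U \<noteq> {}" "\<And>x. x \<in> closure U \<Longrightarrow> norm (z x) \<le> c"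
  shows "sup_norm U z \<le> c"
  unfolding sup_norm_def using assms by (intro cSUP_least) auto

lemma norm_le_sup_norm:
  assumes "bounded U" "z \<in> cont_space \<kappa> U" "x \<in> closure U"
  shows "norm (z x) \<le> sup_norm U z"
proof -
  have "compact ((\<lambda>x. norm (z x)) ` closure U)"
    using assms by (intro compact_continuous_image continuous_intros)
      (auto simp: cont_space_def compact_closure)
  then show ?thesis
    unfolding sup_norm_def using assms(3)
    by (intro cSUP_upper) (auto intro: bounded_imp_bdd_above compact_imp_bounded)
qed

lemma sup_norm_minus_commute:
  "sup_norm U (\<lambda>x. z x - w x) = sup_norm U (\<lambda>x. w x - z x)"
  by (simp add: sup_norm_def norm_minus_commute)

section \<open>Contraction semigroups\<close>

text \<open>
  What the fixed point argument uses of a semigroup: uniform boundedness with constant \<open>C\<close>, and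
  strong continuity in the form of joint continuity in time and space. Bounds are stated pointwise
  and in the Euclidean norm.
\<close>

locale bounded_evolution =
  fixes \<kappa> :: real and U :: "(real^'m) set"
    and S :: "real \<Rightarrow> (real^'m \<Rightarrow> real^'n) \<Rightarrow> (real^'m \<Rightarrow> real^'n)" and C :: real
  assumes U: "U \<noteq> {}" "bounded U"
    and C_pos: "0 < C"
    and S_mem: "0 \<le> t \<Longrightarrow> z \<in> cont_space \<kappa> U \<Longrightarrow> S t z \<in> cont_space \<kappa> U"
    and S_zero: "z \<in> cont_space \<kappa> U \<Longrightarrow> S 0 z = z"
    and S_diff: "0 \<le> t \<Longrightarrow> z \<in> cont_space \<kappa> U \<Longrightarrow> w \<in> cont_space \<kappa> U \<Longrightarrow>
      S t (\<lambda>x. z x - w x) = (\<lambda>x. S t z x - S t w x)"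
    and S_bound: "0 \<le> t \<Longrightarrow> z \<in> cont_space \<kappa> U \<Longrightarrow> (\<And>x. x \<in> closure U \<Longrightarrow> norm (z x) \<le> c) \<Longrightarrow>
      x \<in> closure U \<Longrightarrow> norm (S t z x) \<le> C * c"
    and S_cont: "z \<in> cont_space \<kappa> U \<Longrightarrow> continuous_on ({0..} \<times> closure U) (\<lambda>(t, x). S t z x)"

lemma C0_semigroup_mem:
  assumes "C0_semigroup \<kappa> U T" "0 \<le> t" "z \<in> cont_space \<kappa> U"
  shows "T t z \<in> cont_space \<kappa> U"
  using assms(1)[unfolded C0_semigroup_def, THEN conjunct1] assms(2,3) by blast

lemma C0_semigroup_diff:
  assumes "C0_semigroup \<kappa> U T" "0 \<le> t" "z \<in> cont_space \<kappa> U" "w \<in> cont_space \<kappa> U"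
  shows "T t (\<lambda>x. z x - w x) = (\<lambda>x. T t z x - T t w x)"
proof -
  have "T t (\<lambda>x. a * z x + b * w x) = (\<lambda>x. a * T t z x + b * T t w x)" for a b
    using assms(1)[unfolded C0_semigroup_def, THEN conjunct2, THEN conjunct1] assms(2-4) by blast
  from this[of 1 "-1"] show ?thesis by simp
qed

text \<open>By the semigroup law and contractivity, the change from time \<open>s\<close> to
  \<open>s + h\<close> is at most the change from 0 to \<open>h\<close>. So \<open>\<omega>\<close>,
  which tends to 0 by strong continuity at 0, is a modulus of continuity in time that is uniform in
  space; continuity in space at the limiting time then gives joint continuity.\<close>

lemma C0_contraction_jointly_continuous:
  fixes T :: "real \<Rightarrow> (real^'m \<Rightarrow> real) \<Rightarrow> (real^'m \<Rightarrow> real)"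
  assumes U: "U \<noteq> {}" "bounded U" and T: "C0_semigroup \<kappa> U T"
    and contr: "\<And>t z. 0 \<le> t \<Longrightarrow> z \<in> cont_space \<kappa> U \<Longrightarrow> sup_norm U (T t z) \<le> sup_norm U z"
    and z: "z \<in> cont_space \<kappa> U"
  shows "continuous_on ({0..} \<times> closure U) (\<lambda>(t, x). T t z x)"
proof -
  note mem = C0_semigroup_mem[OF T] and lin = C0_semigroup_diff[OF T]
  have add: "T (s + t) z = T s (T t z)" if "0 \<le> s" "0 \<le> t" for s t
    using T z that unfolding C0_semigroup_def by blast
  define \<omega> where "\<omega> h = sup_norm U (\<lambda>x. T h z x - z x)" for h
  have \<omega>0: "\<omega> 0 = 0"
    using T z U(1) unfolding C0_semigroup_def \<omega>_def by (simp add: sup_norm_def)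
  have "(\<omega> \<longlongrightarrow> 0) (at_right 0)"
    using T z unfolding C0_semigroup_def \<omega>_def by blast
  then have \<omega>_lim: "(\<omega> \<longlongrightarrow> 0) (at 0 within {0..})"
    by (simp add: at_within_Ici_at_right)
  have step: "sup_norm U (\<lambda>x. T (s + h) z x - T s z x) \<le> \<omega> h" if "0 \<le> s" "0 \<le> h" for s h
    using contr[OF that(1) cont_space_diff[OF mem[OF that(2) z] z]] that z
    by (simp add: lin mem add \<omega>_def)
  \<comment> \<open>The smaller of the two times is factored out, so their order does not
    matter.\<close>
  have step': "norm (T t z x - T s z x) \<le> \<omega> \<bar>t - s\<bar>" if "0 \<le> s" "0 \<le> t" "x \<in> closure U" for s t x
  proof (rule order_trans[OF norm_le_sup_norm[OF U(2) cont_space_diff[OF mem mem]]])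
    show "sup_norm U (\<lambda>x. T t z x - T s z x) \<le> \<omega> \<bar>t - s\<bar>"
    proof (cases "s \<le> t")
      case True then show ?thesis using step[of s "t - s"] that by simp
    next
      case False
      then show ?thesis
        using step[of t "s - t"] that by (simp add: sup_norm_minus_commute[of U "T t z"])
    qed
  qed (use that z in auto)
  have \<omega>_cont: "continuous (at 0 within {0..}) \<omega>"
    unfolding continuous_within \<omega>0 by (rule \<omega>_lim)
  show ?thesis
  proof (rule continuous_on_sequentiallyI)
    fix p :: "nat \<Rightarrow> real \<times> (real^'m)" and q
    assume p: "\<forall>n. p n \<in> {0..} \<times> closure U" and q: "q \<in> {0..} \<times> closure U" and lim: "p \<longlonglongrightarrow> q"
    have p1: "0 \<le> fst (p n)" "snd (p n) \<in> closure U" for n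
      using p by (auto simp: mem_Times_iff)
    have q1: "0 \<le> fst q" "snd q \<in> closure U"
      using q by (auto simp: mem_Times_iff)
    have "(\<lambda>n. \<bar>fst (p n) - fst q\<bar>) \<longlonglongrightarrow> \<bar>fst q - fst q\<bar>"
      by (intro tendsto_intros lim)
    then have "(\<lambda>n. \<bar>fst (p n) - fst q\<bar>) \<longlonglongrightarrow> 0" by simp
    from continuous_within_tendsto_compose'[OF \<omega>_cont _ this]
    have 1: "(\<lambda>n. \<omega> \<bar>fst (p n) - fst q\<bar>) \<longlonglongrightarrow> 0" by (simp add: \<omega>0)
    have "continuous_on (closure U) (T (fst q) z)"
      using mem[OF q1(1) z] by (simp add: cont_space_def)
    then have 2: "(\<lambda>n. T (fst q) z (snd (p n))) \<longlonglongrightarrow> T (fst q) z (snd q)"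
      by (rule continuous_on_tendsto_compose) (use p1 q1 lim in \<open>auto intro: tendsto_snd\<close>)
    have "(\<lambda>n. T (fst (p n)) z (snd (p n)) - T (fst q) z (snd (p n))) \<longlonglongrightarrow> 0"
      by (rule Lim_null_comparison[OF _ 1]) (use step' p1 q1 in auto)
    from tendsto_add[OF this 2]
    show "(\<lambda>n. case p n of (t, x) \<Rightarrow> T t z x) \<longlonglongrightarrow> (case q of (t, x) \<Rightarrow> T t z x)"
      by (simp add: split_beta')
  qed
qed

text \<open>The constant arises from bounding the Euclidean norm by the sum of the absolute values
  of the components: each component semigroup is a contraction, so each summand is at most
  \<open>c\<close>.\<close>

lemma bounded_evolution_product_semigroup:
  fixes T :: "'n::finite \<Rightarrow> real \<Rightarrow> (real^'m \<Rightarrow> real) \<Rightarrow> (real^'m \<Rightarrow> real)"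
  assumes U: "U \<noteq> {}" "bounded U" and T: "\<And>i. C0_semigroup \<kappa> U (T i)"
    and contr: "\<And>i t z. 0 \<le> t \<Longrightarrow> z \<in> cont_space \<kappa> U \<Longrightarrow> sup_norm U (T i t z) \<le> sup_norm U z"
  shows "bounded_evolution \<kappa> U (product_semigroup T) (real CARD('n))"
proof
  note mem = C0_semigroup_mem[OF T] and lin = C0_semigroup_diff[OF T]
  show "U \<noteq> {}" "bounded U" "0 < real CARD('n)" using U by auto
  fix t c :: real and z w :: "real^'m \<Rightarrow> real^'n" and x
  assume z: "z \<in> cont_space \<kappa> U"
  show "product_semigroup T 0 z = z"
    using T cont_space_component[OF z] unfolding C0_semigroup_def product_semigroup_def
    by (auto simp: fun_eq_iff vec_eq_iff)
  show "continuous_on ({0..} \<times> closure U) (\<lambda>(t, x). product_semigroup T t z x)"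
    unfolding product_semigroup_def split_beta'
    by (rule continuous_on_vec_lambda, rule C0_contraction_jointly_continuous[unfolded split_beta'])
      (use U T contr cont_space_component[OF z] in auto)
  assume t: "0 \<le> t"
  show "product_semigroup T t z \<in> cont_space \<kappa> U"
    unfolding product_semigroup_def by (intro cont_space_vec_lambda mem t cont_space_component z)
  show "product_semigroup T t (\<lambda>x. z x - w x) = (\<lambda>x. product_semigroup T t z x - product_semigroup T t w x)"
    if "w \<in> cont_space \<kappa> U"
    using that t z by (simp add: product_semigroup_def lin cont_space_component fun_eq_iff vec_eq_iff)
  assume c: "\<And>x. x \<in> closure U \<Longrightarrow> norm (z x) \<le> c" and x: "x \<in> closure U"
  have "norm (product_semigroup T t z x) \<le> (\<Sum>i\<in>(UNIV :: 'n set). \<bar>T i t (\<lambda>x. z x $ i) x\<bar>)"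
    using norm_le_l1_cart[of "product_semigroup T t z x"] by (simp add: product_semigroup_def)
  also have "\<dots> \<le> (\<Sum>i\<in>(UNIV :: 'n set). c)"
  proof (rule sum_mono)
    fix i :: 'n
    have "\<bar>T i t (\<lambda>x. z x $ i) x\<bar> \<le> sup_norm U (T i t (\<lambda>x. z x $ i))"
      using norm_le_sup_norm[OF U(2) mem[OF t cont_space_component[OF z]] x] by simp
    also have "\<dots> \<le> sup_norm U (\<lambda>x. z x $ i)"
      by (intro contr t cont_space_component z)
    also have "\<dots> \<le> c"
      by (rule sup_norm_le[OF U(1)], rule order_trans[OF _ c]) (auto simp: component_le_norm_cart)
    finally show "\<bar>T i t (\<lambda>x. z x $ i) x\<bar> \<le> c" .
  qed
  finally show "norm (product_semigroup T t z x) \<le> real CARD('n) * c" by simp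
qed

section \<open>Separability of \<open>X\<close> and strong measurability\<close>

text \<open>Functions are sorted into countably many classes by a modulus of continuity and by
  approximate values on a finite net. Passing through the nearest net point, two members of a class
  differ by less than four times its accuracy \<open>1 / real (Suc n)\<close>, so one representative
  of each class is enough.\<close>

lemma cont_space_separable:
  fixes U :: "(real^'m) set"
  assumes "bounded U"
  obtains D :: "(real^'m \<Rightarrow> real^'n) set" where "countable D" "D \<subseteq> cont_space \<kappa> U"
    "\<And>z e. z \<in> cont_space \<kappa> U \<Longrightarrow> 0 < e \<Longrightarrow> \<exists>d\<in>D. \<forall>x\<in>closure U. norm (z x - d x) < e"
proof -
  have K: "compact (closure U)" using assms by (simp add: compact_closure)
  have "\<exists>P. finite P \<and> P \<subseteq> closure U \<and> closure U \<subseteq> (\<Union>p\<in>P. ball p (1 / real (Suc k)))" for k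
    by (rule compactE_image[OF K, of "closure U" "\<lambda>p. ball p (1 / real (Suc k))"]) auto
  then obtain P where P: "\<And>k. finite (P k)" "\<And>k. P k \<subseteq> closure U"
    "\<And>k. closure U \<subseteq> (\<Union>p\<in>P k. ball p (1 / real (Suc k)))" by metis
  obtain E :: "(real^'n) set" where E: "countable E" "\<And>X. open X \<Longrightarrow> X \<noteq> {} \<Longrightarrow> \<exists>d\<in>E. d \<in> X"
    by (rule countable_dense_setE) blast
  define I where "I = (\<Union>n::nat. \<Union>k::nat. {n} \<times> {k} \<times> PiE (P k) (\<lambda>_. E))"
  have I: "countable I"
    unfolding I_def using P(1) E(1) by (intro countable_UN countable_SIGMA countable_PiE) auto
  define A where "A = (\<lambda>(n::nat, k::nat, \<phi> :: real^'m \<Rightarrow> real^'n). {z \<in> cont_space \<kappa> U.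
     (\<forall>x\<in>closure U. \<forall>y\<in>closure U. dist x y < 1 / real (Suc k) \<longrightarrow> norm (z x - z y) < 1 / real (Suc n)) \<and>
     (\<forall>p\<in>P k. norm (z p - \<phi> p) < 1 / real (Suc n))})"
  \<comment> \<open>Choosing representatives inside the classes places them in
    \<open>cont_space \<kappa> U\<close>, boundary condition included, without constructing any
    approximating function.\<close>
  define D where "D = (\<lambda>i. SOME z. z \<in> A i) ` {i\<in>I. A i \<noteq> {}}"
  have some_A: "(SOME z. z \<in> A i) \<in> A i" if "A i \<noteq> {}" for i
    using that by (simp add: some_in_eq)
  show thesis
  proof
    show "countable D" unfolding D_def using I by auto
    show "D \<subseteq> cont_space \<kappa> U"
      unfolding D_def using some_A by (fastforce simp: A_def)
    fix z :: "real^'m \<Rightarrow> real^'n" and e :: real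
    assume z: "z \<in> cont_space \<kappa> U" and e: "0 < e"
    from reals_Archimedean[of "e / 4"] e obtain n where n: "1 / real (Suc n) < e / 4"
      by (auto simp: inverse_eq_divide)
    have "uniformly_continuous_on (closure U) z"
      using z K by (intro compact_uniformly_continuous) (auto simp: cont_space_def)
    then obtain r where r: "0 < r"
      "\<And>x y. x \<in> closure U \<Longrightarrow> y \<in> closure U \<Longrightarrow> dist x y < r \<Longrightarrow> dist (z x) (z y) < 1 / real (Suc n)"
      unfolding uniformly_continuous_on_def by (metis dist_commute of_nat_0_less_iff zero_less_Suc zero_less_divide_1_iff)
    from reals_Archimedean[OF r(1)] obtain k where k: "1 / real (Suc k) < r"
      by (auto simp: inverse_eq_divide)
    have "\<exists>y\<in>E. norm (z p - y) < 1 / real (Suc n)" for p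
      using E(2)[of "ball (z p) (1 / real (Suc n))"] by (auto simp: dist_norm)
    then obtain \<psi> where \<psi>: "\<And>p. \<psi> p \<in> E" "\<And>p. norm (z p - \<psi> p) < 1 / real (Suc n)" by metis
    \<comment> \<open>Forgetting the values of \<open>\<psi>\<close> off the net puts the index into
      the countable set \<open>I\<close>.\<close>
    define i where "i = (n, k, restrict \<psi> (P k))"
    have zi: "z \<in> A i"
      using z r(2) k \<psi>(2) by (force simp: A_def i_def dist_norm)
    have iI: "i \<in> I" unfolding I_def i_def using \<psi>(1) by auto
    define d where "d = (SOME z. z \<in> A i)"
    have di: "d \<in> A i" unfolding d_def using zi some_A by blast
    have dD: "d \<in> D" unfolding D_def d_def using zi iI by blast
    have "norm (z x - d x) < e" if x: "x \<in> closure U" for x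
    proof -
      obtain p where p: "p \<in> P k" "dist x p < 1 / real (Suc k)"
        using P(3)[of k] x by (auto simp: dist_commute)
      have pU: "p \<in> closure U" using p P(2) by auto
      have 1: "norm (w x - w p) < e / 4" "norm (w p - \<psi> p) < e / 4" if "w \<in> A i" for w
        using that x p pU n by (force simp: A_def i_def)+
      have "z x - d x = (z x - z p) + (z p - \<psi> p) - (d p - \<psi> p) - (d x - d p)" by simp
      also have "norm \<dots> \<le> norm (z x - z p) + norm (z p - \<psi> p) + norm (d p - \<psi> p) + norm (d x - d p)"
        by (smt (verit) norm_triangle_ineq norm_triangle_ineq4)
      also have "\<dots> < e" using 1[OF zi] 1[OF di] by simp
      finally show ?thesis .
    qed
    then show "\<exists>d\<in>D. \<forall>x\<in>closure U. norm (z x - d x) < e" using dD by blast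
  qed
qed

text \<open>By continuity in space the supremum may be taken over a countable dense set of points,
  which turns a sublevel set into a countable intersection.\<close>

lemma borel_measurable_X_norm:
  fixes F :: "'a \<Rightarrow> real^'m \<Rightarrow> real^'n"
  assumes U: "U \<noteq> {}" "bounded U"
    and F: "\<And>\<tau>. \<tau> \<in> space M \<Longrightarrow> F \<tau> \<in> cont_space \<kappa> U"
    and [measurable]: "\<And>x. x \<in> closure U \<Longrightarrow> (\<lambda>\<tau>. F \<tau> x) \<in> borel_measurable M"
  shows "(\<lambda>\<tau>. X_norm U (F \<tau>)) \<in> borel_measurable M"
proof (rule borel_measurableI_le)
  fix c
  obtain Q where Q: "countable Q" "Q \<subseteq> closure U" "closure U \<subseteq> closure Q"
    by (rule separable)
  have "X_norm U (F \<tau>) \<le> c \<longleftrightarrow> (\<forall>x\<in>Q. norm1 (F \<tau> x) \<le> c)" if \<tau>: "\<tau> \<in> space M" for \<tau>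
  proof
    assume "X_norm U (F \<tau>) \<le> c"
    then show "\<forall>x\<in>Q. norm1 (F \<tau> x) \<le> c"
      using norm1_le_X_norm[OF U(2) F[OF \<tau>]] Q(2) by (meson order_trans subsetD)
  next
    assume c: "\<forall>x\<in>Q. norm1 (F \<tau> x) \<le> c"
    have "closure Q = closure U"
      using Q(2,3) by (metis closed_closure closure_minimal subset_antisym)
    moreover have "continuous_on (closure U) (\<lambda>x. norm1 (F \<tau> x))"
      using F[OF \<tau>] by (intro continuous_intros) (simp add: cont_space_def)
    ultimately have "norm1 (F \<tau> x) \<le> c" if "x \<in> closure U" for x
      using continuous_le_on_closure[of Q "\<lambda>x. norm1 (F \<tau> x)" x c] c that by simp
    then show "X_norm U (F \<tau>) \<le> c" by (intro X_norm_le U)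
  qed
  then have "{\<tau> \<in> space M. X_norm U (F \<tau>) \<le> c} = {\<tau> \<in> space M. \<forall>x\<in>Q. norm1 (F \<tau> x) \<le> c}"
    by auto
  also have "\<dots> \<in> sets M"
  proof -
    have "{\<tau> \<in> space M. \<not> norm1 (F \<tau> x) \<le> c} \<in> sets M" if "x \<in> Q" for x
    proof -
      from that Q(2) have [measurable]: "(\<lambda>\<tau>. F \<tau> x) \<in> borel_measurable M" by auto
      show ?thesis by measurable
    qed
    then have "space M - (\<Union>x\<in>Q. {\<tau> \<in> space M. \<not> norm1 (F \<tau> x) \<le> c}) \<in> sets M"
      using Q(1) by (intro sets.compl_sets sets.countable_UN'') auto
    also have "space M - (\<Union>x\<in>Q. {\<tau> \<in> space M. \<not> norm1 (F \<tau> x) \<le> c}) =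
      {\<tau> \<in> space M. \<forall>x\<in>Q. norm1 (F \<tau> x) \<le> c}" by auto
    finally show ?thesis .
  qed
  finally show "{\<tau> \<in> space M. X_norm U (F \<tau>) \<le> c} \<in> sets M" .
qed

text \<open>
  Pettis' theorem for \<open>X\<close>: as \<open>X\<close> is separable, measurability of all evaluations gives strong
  measurability. The approximation \<open>s n\<close> picks a best approximation among the first \<open>n\<close> points of
  a dense sequence starting with \<open>0\<close>, which gives the domination.
\<close>

lemma simple_approximation:
  fixes F :: "'a \<Rightarrow> real^'m \<Rightarrow> real^'n"
  assumes U: "U \<noteq> {}" "bounded U"
    and F: "\<And>\<tau>. \<tau> \<in> space M \<Longrightarrow> F \<tau> \<in> cont_space \<kappa> U"
    and F_meas [measurable]: "\<And>x. x \<in> closure U \<Longrightarrow> (\<lambda>\<tau>. F \<tau> x) \<in> borel_measurable M"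
  obtains s where "\<And>n::nat. simple_function M (s n)" "\<And>n \<tau>. s n \<tau> \<in> cont_space \<kappa> U"
    "\<And>n. (\<lambda>\<tau>. X_norm U (\<lambda>x. F \<tau> x - s n \<tau> x)) \<in> borel_measurable M"
    "\<And>n \<tau>. \<tau> \<in> space M \<Longrightarrow> X_norm U (\<lambda>x. F \<tau> x - s n \<tau> x) \<le> X_norm U (F \<tau>)"
    "\<And>\<tau>. \<tau> \<in> space M \<Longrightarrow> (\<lambda>n. X_norm U (\<lambda>x. F \<tau> x - s n \<tau> x)) \<longlonglongrightarrow> 0"
proof -
  obtain D :: "(real^'m \<Rightarrow> real^'n) set" where D: "countable D" "D \<subseteq> cont_space \<kappa> U"
    "\<And>z e. z \<in> cont_space \<kappa> U \<Longrightarrow> 0 < e \<Longrightarrow> \<exists>d\<in>D. \<forall>x\<in>closure U. norm (z x - d x) < e"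
    using cont_space_separable[OF U(2), where \<kappa>=\<kappa>] by metis
  have "D \<noteq> {}" using D(3)[of "\<lambda>_. 0" 1] by auto
  then have rD: "range (from_nat_into D) = D" using D(1) by (rule range_from_nat_into)
  define d where "d n = (case n of 0 \<Rightarrow> (\<lambda>_. 0) | Suc m \<Rightarrow> from_nat_into D m)" for n
  have d: "d n \<in> cont_space \<kappa> U" for n
    using rD D(2) by (cases n) (auto simp: d_def)
  have d0: "d 0 = (\<lambda>_. 0)" by (simp add: d_def)
  define h where "h k \<tau> = X_norm U (\<lambda>x. F \<tau> x - d k x)" for k \<tau>
  have h_meas [measurable]: "h k \<in> borel_measurable M" for k
    unfolding h_def using F d
    by (intro borel_measurable_X_norm[OF U] cont_space_diff) (auto intro: borel_measurable_diff)
  \<comment> \<open>\<open>LEAST\<close> breaks ties by the smallest index; the chosen index is then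
    described by countably many comparisons of measurable functions.\<close>
  define j where "j n \<tau> = (LEAST k. k \<le> n \<and> (\<forall>i\<le>n. h k \<tau> \<le> h i \<tau>))" for n \<tau>
  have j_meas: "j n \<in> measurable M (count_space UNIV)" for n
    unfolding j_def by measurable
  have j: "j n \<tau> \<le> n \<and> (\<forall>i\<le>n. h (j n \<tau>) \<tau> \<le> h i \<tau>)" for n \<tau>
  proof -
    have "\<exists>k. is_arg_min (\<lambda>k. h k \<tau>) (\<lambda>k. k \<in> {..n}) k"
      by (rule ex_is_arg_min_if_finite) auto
    then obtain k where "k \<le> n \<and> (\<forall>i\<le>n. h k \<tau> \<le> h i \<tau>)"
      by (auto simp: is_arg_min_linorder)
    then show ?thesis unfolding j_def by (rule LeastI)
  qed
  have h_nonneg: "0 \<le> h k \<tau>" if "\<tau> \<in> space M" for k \<tau>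
    unfolding h_def by (rule X_norm_nonneg[OF U cont_space_diff[OF F[OF that] d]])
  show thesis
  proof
    fix n :: nat
    show "simple_function M (\<lambda>\<tau>. d (j n \<tau>))"
      unfolding simple_function_eq_measurable
    proof
      show "finite ((\<lambda>\<tau>. d (j n \<tau>)) ` space M)"
        by (rule finite_subset[of _ "d ` {..n}"]) (use j in auto)
      show "(\<lambda>\<tau>. d (j n \<tau>)) \<in> measurable M (count_space UNIV)"
        by (rule measurable_compose[OF j_meas]) simp
    qed
    show "(\<lambda>\<tau>. X_norm U (\<lambda>x. F \<tau> x - d (j n \<tau>) x)) \<in> borel_measurable M"
      using measurable_compose_countable[OF h_meas j_meas] by (simp add: h_def)
    show "d (j n \<tau>) \<in> cont_space \<kappa> U" for \<tau> by (rule d)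
  next
    fix n \<tau> assume "\<tau> \<in> space M"
    show "X_norm U (\<lambda>x. F \<tau> x - d (j n \<tau>) x) \<le> X_norm U (F \<tau>)"
      using j[of n \<tau>] d0 by (auto simp: h_def dest: spec[of _ 0])
  next
    fix \<tau> assume \<tau>: "\<tau> \<in> space M"
    show "(\<lambda>n. X_norm U (\<lambda>x. F \<tau> x - d (j n \<tau>) x)) \<longlonglongrightarrow> 0"
    proof (rule LIMSEQ_I)
      fix e :: real assume e: "0 < e"
      then obtain w where w: "w \<in> D" "\<And>x. x \<in> closure U \<Longrightarrow> norm (F \<tau> x - w x) < e / (2 * real CARD('n))"
        using D(3)[OF F[OF \<tau>], of "e / (2 * real CARD('n))"] by auto
      from w(1) rD obtain m where "w = from_nat_into D m" by blast
      then have m: "w = d (Suc m)" by (simp add: d_def)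
      have "h (Suc m) \<tau> \<le> real CARD('n) * (e / (2 * real CARD('n)))"
        unfolding h_def m[symmetric] using w(2) by (intro X_norm_le_norm U) (simp add: less_imp_le)
      then have "h (Suc m) \<tau> < e" using e by simp
      then have "norm (h (j n \<tau>) \<tau> - 0) < e" if "n \<ge> Suc m" for n
        using j[of n \<tau>] that h_nonneg[OF \<tau>, of "j n \<tau>"] by fastforce
      then show "\<exists>N. \<forall>n\<ge>N. norm (X_norm U (\<lambda>x. F \<tau> x - d (j n \<tau>) x) - 0) < e"
        unfolding h_def by blast
    qed
  qed
qed

section \<open>Bochner integrals through evaluations\<close>

text \<open>This rests on completeness of Lebesgue measure, applied to the extensions by 0 to the
  whole space.\<close>

lemma borel_measurable_lebesgue_on_AE:
  fixes f g :: "'a::euclidean_space \<Rightarrow> 'b::euclidean_space"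
  assumes "S \<in> sets lebesgue" "f \<in> borel_measurable (lebesgue_on S)"
    and "AE x in lebesgue_on S. f x = g x"
  shows "g \<in> borel_measurable (lebesgue_on S)"
proof -
  have "AE x in lebesgue. (if x \<in> S then f x else 0) = (if x \<in> S then g x else 0)"
    using assms(1,3) by (subst (asm) AE_restrict_space_iff) auto
  with assms(1,2) show ?thesis
    unfolding borel_measurable_if[OF assms(1), symmetric] by (rule_tac borel_measurable_AE)
qed

lemma step_integral_mem:
  assumes "s ` J \<subseteq> cont_space \<kappa> U"
  shows "step_integral J s \<in> cont_space \<kappa> U"
proof -
  have s: "v \<in> cont_space \<kappa> U" if "v \<in> s ` J" for v using assms that by blast
  then have "continuous_on (closure U) (step_integral J s)"
    unfolding step_integral_def by (intro continuous_intros) (simp add: cont_space_def)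
  moreover have "step_integral J s x = 0" if "\<And>v. v \<in> s ` J \<Longrightarrow> v x = 0" for x
    unfolding step_integral_def using that by (intro sum.neutral) auto
  ultimately show ?thesis using s by (auto simp: cont_space_def)
qed

text \<open>The level sets are indexed by the values \<open>v\<close> in \<open>X\<close> and not by
  the numbers \<open>v x\<close>, which may coincide for different \<open>v\<close>; the sum of
  indicators is correct in either case.\<close>

lemma has_bochner_integral_step_integral:
  assumes J: "J \<in> lmeasurable" and s: "simple_function (lebesgue_on J) s"
  shows "has_bochner_integral (lebesgue_on J) (\<lambda>\<tau>. s \<tau> x) (step_integral J s x)"
proof -
  interpret finite_measure "lebesgue_on J" by (rule finite_measure_lebesgue_on[OF J])
  have fin: "finite (s ` J)" using simple_functionD(1)[OF s] by simp
  have meas: "{\<tau>\<in>J. s \<tau> = v} \<in> sets (lebesgue_on J)" for v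
    using simple_functionD(2)[OF s, of "{v}"] by (simp add: vimage_def Int_def conj_commute)
  have "has_bochner_integral (lebesgue_on J)
      (\<lambda>\<tau>. \<Sum>v\<in>s ` J. indicator {\<tau>\<in>J. s \<tau> = v} \<tau> *\<^sub>R v x) (step_integral J s x)"
    unfolding step_integral_def using meas
    by (intro has_bochner_integral_sum has_bochner_integral_indicator) (auto simp: less_top[symmetric])
  moreover have "(\<Sum>v\<in>s ` J. indicator {\<tau>\<in>J. s \<tau> = v} \<tau> *\<^sub>R v x) = s \<tau> x" if "\<tau> \<in> J" for \<tau>
  proof -
    have "(\<Sum>v\<in>s ` J. indicator {\<tau>\<in>J. s \<tau> = v} \<tau> *\<^sub>R v x) = (\<Sum>v\<in>s ` J. if s \<tau> = v then v x else 0)"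
      using that by (intro sum.cong) auto
    then show ?thesis using fin that by simp
  qed
  ultimately show ?thesis
    by (subst (asm) has_bochner_integral_cong[OF refl _ refl]) auto
qed

text \<open>This bridges the gap between the forcing, which lies in \<open>X\<close> only almost
  everywhere, and \<open>simple_approximation\<close>, which asks for values in \<open>X\<close>
  everywhere.\<close>

lemma AE_cont_space_modification:
  fixes F :: "real \<Rightarrow> real^'m \<Rightarrow> real^'n"
  assumes J: "J \<in> sets lebesgue"
    and F: "AE \<tau> in lebesgue_on J. F \<tau> \<in> cont_space \<kappa> U"
    and F_meas: "\<And>x. x \<in> closure U \<Longrightarrow> (\<lambda>\<tau>. F \<tau> x) \<in> borel_measurable (lebesgue_on J)"
  shows "\<exists>F'. (\<forall>\<tau>. F' \<tau> \<in> cont_space \<kappa> U) \<and> (AE \<tau> in lebesgue_on J. F' \<tau> = F \<tau>) \<and>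
    (\<forall>x\<in>closure U. (\<lambda>\<tau>. F' \<tau> x) \<in> borel_measurable (lebesgue_on J))"
proof (intro exI conjI allI ballI)
  define F' where "F' = (\<lambda>\<tau>. if F \<tau> \<in> cont_space \<kappa> U then F \<tau> else (\<lambda>_. 0))"
  show "F' \<tau> \<in> cont_space \<kappa> U" for \<tau> by (simp add: F'_def)
  show eq: "AE \<tau> in lebesgue_on J. F' \<tau> = F \<tau>"
    using F by eventually_elim (simp add: F'_def)
  show "(\<lambda>\<tau>. F' \<tau> x) \<in> borel_measurable (lebesgue_on J)" if "x \<in> closure U" for x
    by (rule borel_measurable_lebesgue_on_AE[OF J F_meas[OF that]])
      (use eq in \<open>eventually_elim, simp\<close>)
qed

text \<open>The simple approximations of a modified integrand have errors \<open>E n\<close> that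
  tend to 0 and are dominated by a multiple of \<open>g\<close>. Dominated convergence makes their
  integrals tend to 0, and these integrals bound the distance from the step integrals to the
  pointwise integral.\<close>

lemma has_X_integralI:
  fixes F :: "real \<Rightarrow> real^'m \<Rightarrow> real^'n"
  assumes U: "U \<noteq> {}" "bounded U" and J: "J \<in> lmeasurable"
    and F: "AE \<tau> in lebesgue_on J. F \<tau> \<in> cont_space \<kappa> U"
    and F_meas: "\<And>x. x \<in> closure U \<Longrightarrow> (\<lambda>\<tau>. F \<tau> x) \<in> borel_measurable (lebesgue_on J)"
    and bound: "AE \<tau> in lebesgue_on J. \<forall>x\<in>closure U. norm (F \<tau> x) \<le> g \<tau>"
    and g: "integrable (lebesgue_on J) g"
  shows "has_X_integral \<kappa> U J F (\<lambda>x. LINT \<tau>|lebesgue_on J. F \<tau> x)"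
proof -
  let ?M = "lebesgue_on J"
  define I where "I = (\<lambda>x. LINT \<tau>|?M. F \<tau> x)"
  obtain F' where F': "\<And>\<tau>. F' \<tau> \<in> cont_space \<kappa> U" and eq: "AE \<tau> in ?M. F' \<tau> = F \<tau>"
    and F'_meas: "\<And>x. x \<in> closure U \<Longrightarrow> (\<lambda>\<tau>. F' \<tau> x) \<in> borel_measurable ?M"
    using AE_cont_space_modification[OF fmeasurableD[OF J] F F_meas] by blast
  obtain s where s: "\<And>n::nat. simple_function ?M (s n)" "\<And>n \<tau>. s n \<tau> \<in> cont_space \<kappa> U"
    "\<And>n. (\<lambda>\<tau>. X_norm U (\<lambda>x. F' \<tau> x - s n \<tau> x)) \<in> borel_measurable ?M"
    "\<And>n \<tau>. \<tau> \<in> space ?M \<Longrightarrow> X_norm U (\<lambda>x. F' \<tau> x - s n \<tau> x) \<le> X_norm U (F' \<tau>)"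
    "\<And>\<tau>. \<tau> \<in> space ?M \<Longrightarrow> (\<lambda>n. X_norm U (\<lambda>x. F' \<tau> x - s n \<tau> x)) \<longlonglongrightarrow> 0"
    using simple_approximation[OF U F' F'_meas] by blast
  define E where "E n \<tau> = X_norm U (\<lambda>x. F' \<tau> x - s n \<tau> x)" for n \<tau>
  have E_nonneg: "0 \<le> E n \<tau>" for n \<tau>
    unfolding E_def by (rule X_norm_nonneg[OF U cont_space_diff[OF F' s(2)]])
  have E_bound: "AE \<tau> in ?M. norm (E n \<tau>) \<le> real CARD('n) * g \<tau>" for n
    using eq bound AE_space
  proof eventually_elim
    case (elim \<tau>)
    have "E n \<tau> \<le> X_norm U (F' \<tau>)" unfolding E_def by (rule s(4)[OF elim(3)])
    also have "\<dots> \<le> real CARD('n) * g \<tau>" using elim by (intro X_norm_le_norm U) auto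
    finally show ?case using E_nonneg[of n \<tau>] by simp
  qed
  have E_meas: "E n \<in> borel_measurable ?M" for n
    using s(3)[of n] by (simp add: E_def[abs_def])
  have E_int: "integrable ?M (E n)" for n
  proof (rule Bochner_Integration.integrable_bound[OF integrable_mult_right[OF g, of "real CARD('n)"] E_meas])
    show "AE \<tau> in ?M. norm (E n \<tau>) \<le> norm (real CARD('n) * g \<tau>)"
      using E_bound[of n] by eventually_elim (erule order_trans, simp only: real_norm_def abs_ge_self)
  qed
  have "(\<lambda>n. integral\<^sup>L ?M (E n)) \<longlonglongrightarrow> (LINT \<tau>|?M. 0)"
  proof (rule integral_dominated_convergence[OF _ E_meas _ _ E_bound])
    show "AE \<tau> in ?M. (\<lambda>n. E n \<tau>) \<longlonglongrightarrow> 0"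
      unfolding E_def using s(5) by (rule AE_I2)
  qed (use g in auto)
  then have E_lim: "(\<lambda>n. integral\<^sup>L ?M (E n)) \<longlonglongrightarrow> 0" by simp
  have F'_bound: "AE \<tau> in ?M. norm (F' \<tau> x) \<le> norm (g \<tau>)" if "x \<in> closure U" for x
    using eq bound by eventually_elim (use that in fastforce)
  have F'_int: "integrable ?M (\<lambda>\<tau>. F' \<tau> x)" if "x \<in> closure U" for x
    by (rule Bochner_Integration.integrable_bound[OF g F'_meas[OF that] F'_bound[OF that]])
  have I_eq: "I x = (LINT \<tau>|?M. F' \<tau> x)" if "x \<in> closure U" for x
    unfolding I_def by (rule integral_cong_AE) (use F_meas F'_meas that eq in auto)
  \<comment> \<open>This serves twice: outside \<open>closure U\<close>, and on the frontier in the
    Dirichlet case.\<close>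
  have I_0: "I x = 0" if "AE \<tau> in ?M. F' \<tau> x = 0" for x
  proof -
    have "AE \<tau> in ?M. F \<tau> x = 0" using that eq by eventually_elim simp
    then show ?thesis unfolding I_def by (rule integral_eq_zero_AE)
  qed
  have "continuous_on (closure U) I"
  proof (rule continuous_on_sequentiallyI)
    fix p :: "nat \<Rightarrow> real^'m" and a
    assume p: "\<forall>n. p n \<in> closure U" "a \<in> closure U" "p \<longlonglongrightarrow> a"
    have "(\<lambda>n. LINT \<tau>|?M. F' \<tau> (p n)) \<longlonglongrightarrow> (LINT \<tau>|?M. F' \<tau> a)"
    proof (rule integral_dominated_convergence[where w="\<lambda>\<tau>. norm (g \<tau>)"])
      show "AE \<tau> in ?M. (\<lambda>n. F' \<tau> (p n)) \<longlonglongrightarrow> F' \<tau> a"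
      proof (rule AE_I2)
        fix \<tau>
        have "continuous_on (closure U) (F' \<tau>)" using F' by (simp add: cont_space_def)
        then show "(\<lambda>n. F' \<tau> (p n)) \<longlonglongrightarrow> F' \<tau> a"
          by (rule continuous_on_tendsto_compose) (use p in auto)
      qed
    qed (use p F'_meas F'_bound g in auto)
    then show "(\<lambda>n. I (p n)) \<longlonglongrightarrow> I a" using p I_eq by simp
  qed
  then have I: "I \<in> cont_space \<kappa> U"
    using I_0 F' by (auto simp: cont_space_def)
  \<comment> \<open>\<open>E n\<close> bounds the integrands at all points simultaneously, so
    estimates at single points add up to one in the norm of \<open>X\<close>.\<close>
  have step: "X_norm U (\<lambda>x. step_integral J (s n) x - I x) \<le> real CARD('n) * integral\<^sup>L ?M (E n)" for n
  proof (rule X_norm_le_norm[OF U(1)])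
    fix x assume x: "x \<in> closure U"
    note st = has_bochner_integral_step_integral[OF J s(1)[of n], of x]
    have "step_integral J (s n) x - I x = (LINT \<tau>|?M. s n \<tau> x - F' \<tau> x)"
      using st F'_int[OF x] by (simp add: I_eq[OF x] has_bochner_integral_iff)
    also have "norm \<dots> \<le> (LINT \<tau>|?M. E n \<tau>)"
    proof (rule Bochner_Integration.integral_norm_bound_integral)
      show "integrable ?M (\<lambda>\<tau>. s n \<tau> x - F' \<tau> x)"
        using st F'_int[OF x] by (simp add: has_bochner_integral_iff)
      show "norm (s n \<tau> x - F' \<tau> x) \<le> E n \<tau>" for \<tau>
        using norm_le_X_norm[OF U(2) cont_space_diff[OF F' s(2)] x]
        by (simp add: E_def norm_minus_commute)
    qed (rule E_int)
    finally show "norm (step_integral J (s n) x - I x) \<le> integral\<^sup>L ?M (E n)" .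
  qed
  show ?thesis
    unfolding has_X_integral_def I_def[symmetric]
  proof (intro conjI exI[of _ s] allI)
    show "(\<lambda>n. X_norm U (\<lambda>x. step_integral J (s n) x - I x)) \<longlonglongrightarrow> 0"
    proof (rule tendsto_sandwich[OF _ _ tendsto_const])
      show "\<forall>\<^sub>F n in sequentially. 0 \<le> X_norm U (\<lambda>x. step_integral J (s n) x - I x)"
        by (intro always_eventually allI X_norm_nonneg[OF U cont_space_diff[OF step_integral_mem I]])
          (use s(2) in auto)
      show "(\<lambda>n. real CARD('n) * integral\<^sup>L ?M (E n)) \<longlonglongrightarrow> 0"
        using tendsto_mult_right_zero[OF E_lim] by simp
    qed (simp add: step)
    have "(\<integral>\<^sup>+\<tau>. ennreal (X_norm U (\<lambda>x. F \<tau> x - s n \<tau> x)) \<partial>?M) = ennreal (integral\<^sup>L ?M (E n))" for n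
    proof -
      have "(\<integral>\<^sup>+\<tau>. ennreal (X_norm U (\<lambda>x. F \<tau> x - s n \<tau> x)) \<partial>?M) = (\<integral>\<^sup>+\<tau>. ennreal (E n \<tau>) \<partial>?M)"
        using eq by (intro nn_integral_cong_AE, eventually_elim) (simp add: E_def)
      then show ?thesis using E_nonneg E_int by (simp add: nn_integral_eq_integral)
    qed
    then show "(\<lambda>n. \<integral>\<^sup>+\<tau>. ennreal (X_norm U (\<lambda>x. F \<tau> x - s n \<tau> x)) \<partial>?M) \<longlonglongrightarrow> 0"
      using tendsto_ennrealI[OF E_lim] by simp
    show "AE \<tau> in ?M. (\<lambda>n. X_norm U (\<lambda>x. F \<tau> x - s n \<tau> x)) \<longlonglongrightarrow> 0"
      using eq AE_space
    proof eventually_elim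
      case (elim \<tau>)
      from s(5)[OF elim(2)] show ?case by (simp add: elim(1))
    qed
  qed (use I F s in auto)
qed

text \<open>Evaluation at a point is a bounded linear map on \<open>X\<close> and hence commutes
  with the Bochner integral. In particular the integral is unique, which the definition by
  approximation does not show.\<close>

lemma has_X_integral_pointwise:
  fixes F :: "real \<Rightarrow> real^'m \<Rightarrow> real^'n"
  assumes U: "U \<noteq> {}" "bounded U" and J: "J \<in> lmeasurable"
    and F_int: "has_X_integral \<kappa> U J F I"
  shows "I x = (LINT \<tau>|lebesgue_on J. F \<tau> x)"
proof -
  let ?M = "lebesgue_on J"
  from F_int obtain s where I: "I \<in> cont_space \<kappa> U" and F: "AE \<tau> in ?M. F \<tau> \<in> cont_space \<kappa> U"
    and s: "\<And>n::nat. simple_function ?M (s n)" "\<And>n. s n ` J \<subseteq> cont_space \<kappa> U"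
    and lim: "AE \<tau> in ?M. (\<lambda>n. X_norm U (\<lambda>x. F \<tau> x - s n \<tau> x)) \<longlonglongrightarrow> 0"
    and L1: "(\<lambda>n. \<integral>\<^sup>+\<tau>. ennreal (X_norm U (\<lambda>x. F \<tau> x - s n \<tau> x)) \<partial>?M) \<longlonglongrightarrow> 0"
    and step: "(\<lambda>n. X_norm U (\<lambda>x. step_integral J (s n) x - I x)) \<longlonglongrightarrow> 0"
    unfolding has_X_integral_def by blast
  show ?thesis
  proof (cases "x \<in> closure U")
    case False
    have "AE \<tau> in ?M. F \<tau> x = 0"
      using F by eventually_elim (use False in \<open>simp add: cont_space_def\<close>)
    then have "(LINT \<tau>|?M. F \<tau> x) = 0" by (rule integral_eq_zero_AE)
    then show ?thesis using I False by (simp add: cont_space_def)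
  next
    case x: True
    note st = has_bochner_integral_step_integral[OF J s(1), of _ x]
    have st_int: "integrable ?M (\<lambda>\<tau>. s n \<tau> x)" for n
      using st by (simp add: has_bochner_integral_iff)
    have le: "AE \<tau> in ?M. \<forall>n. norm (F \<tau> x - s n \<tau> x) \<le> X_norm U (\<lambda>x. F \<tau> x - s n \<tau> x)"
      using F AE_space
    proof eventually_elim
      case (elim \<tau>)
      then show ?case using s(2) by (auto intro!: norm_le_X_norm[OF U(2) cont_space_diff x])
    qed
    have conv: "AE \<tau> in ?M. (\<lambda>n. s n \<tau> x) \<longlonglongrightarrow> F \<tau> x"
      using le lim
    proof eventually_elim
      case (elim \<tau>)
      have "(\<lambda>n. F \<tau> x - s n \<tau> x) \<longlonglongrightarrow> 0"
        by (rule Lim_null_comparison[OF _ elim(2)]) (use elim(1) in auto)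
      from tendsto_diff[OF tendsto_const[of "F \<tau> x"] this] show ?case by simp
    qed
    \<comment> \<open>Measurability of the evaluations of \<open>F\<close> is not assumed; it is
      inherited from the simple functions through their almost everywhere limit.\<close>
    have "(\<lambda>\<tau>. lim (\<lambda>n. s n \<tau> x)) \<in> borel_measurable ?M"
      by (rule borel_measurable_lim_metric) (use st_int in auto)
    then have F_meas: "(\<lambda>\<tau>. F \<tau> x) \<in> borel_measurable ?M"
      by (rule borel_measurable_lebesgue_on_AE[OF fmeasurableD[OF J]])
        (use conv in \<open>eventually_elim, simp add: limI\<close>)
    have L1x: "(\<lambda>n. \<integral>\<^sup>+\<tau>. ennreal (norm (s n \<tau> x - F \<tau> x)) \<partial>?M) \<longlonglongrightarrow> 0"
    proof (rule tendsto_sandwich[OF _ _ tendsto_const L1])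
      have "(\<integral>\<^sup>+\<tau>. ennreal (norm (s n \<tau> x - F \<tau> x)) \<partial>?M)
          \<le> (\<integral>\<^sup>+\<tau>. ennreal (X_norm U (\<lambda>x. F \<tau> x - s n \<tau> x)) \<partial>?M)" for n
      proof (rule nn_integral_mono_AE)
        show "AE \<tau> in ?M. ennreal (norm (s n \<tau> x - F \<tau> x)) \<le> ennreal (X_norm U (\<lambda>x. F \<tau> x - s n \<tau> x))"
          using le by eventually_elim (auto simp: norm_minus_commute intro: ennreal_leI)
      qed
      then show "\<forall>\<^sub>F n in sequentially. (\<integral>\<^sup>+\<tau>. ennreal (norm (s n \<tau> x - F \<tau> x)) \<partial>?M)
          \<le> (\<integral>\<^sup>+\<tau>. ennreal (X_norm U (\<lambda>x. F \<tau> x - s n \<tau> x)) \<partial>?M)"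
        by simp
    qed simp
    \<comment> \<open>Integrability of the evaluation of \<open>F\<close> comes from a single
      integrable approximant at finite distance in mean; the bound 1 stands for any finite
      number.\<close>
    have "\<exists>n. (\<integral>\<^sup>+\<tau>. ennreal (norm (s n \<tau> x - F \<tau> x)) \<partial>?M) < 1"
      using order_tendstoD(2)[OF L1x, of 1] by (auto dest: eventually_happens)
    then obtain n where n: "(\<integral>\<^sup>+\<tau>. ennreal (norm (s n \<tau> x - F \<tau> x)) \<partial>?M) < 1" by blast
    have "integrable ?M (\<lambda>\<tau>. s n \<tau> x - F \<tau> x)"
      using n st_int[of n] F_meas
      by (intro integrableI_bounded borel_measurable_diff) (auto intro: less_trans)
    from Bochner_Integration.integrable_diff[OF st_int[of n] this]
    have "integrable ?M (\<lambda>\<tau>. F \<tau> x)" by simp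
    from tendsto_L1_int[OF st_int this L1x]
    have 1: "(\<lambda>n. step_integral J (s n) x) \<longlonglongrightarrow> (LINT \<tau>|?M. F \<tau> x)"
      using st by (simp add: has_bochner_integral_iff)
    have step_mem: "step_integral J (s n) \<in> cont_space \<kappa> U" for n
      by (rule step_integral_mem[OF s(2)])
    have "(\<lambda>n. step_integral J (s n) x - I x) \<longlonglongrightarrow> 0"
      by (rule Lim_null_comparison[OF _ step])
        (intro always_eventually allI norm_le_X_norm[OF U(2) cont_space_diff[OF step_mem I] x])
    from tendsto_add[OF this tendsto_const[of "I x"]]
    have "(\<lambda>n. step_integral J (s n) x) \<longlonglongrightarrow> I x" by simp
    from LIMSEQ_unique[OF this 1] show ?thesis .
  qed
qed

section \<open>Dominated integrands and restriction to parts of the time interval\<close>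

lemma norm_integral_le_AE:
  fixes h :: "'a \<Rightarrow> 'b::{banach, second_countable_topology}"
  assumes "integrable M h" "integrable M m" "AE \<tau> in M. norm (h \<tau>) \<le> m \<tau>"
  shows "norm (integral\<^sup>L M h) \<le> integral\<^sup>L M m"
  by (rule order_trans[OF integral_norm_bound integral_mono_AE]) (use assms in auto)

text \<open>The conditions of \<open>has_X_integralI\<close> in one predicate. The majorant
  \<open>m\<close> is the same for all points of space, which makes it a bound in
  \<open>X\<close>.\<close>

definition dominated ::
  "real \<Rightarrow> (real^'m) set \<Rightarrow> real set \<Rightarrow> (real \<Rightarrow> real^'m \<Rightarrow> real^'n) \<Rightarrow> (real \<Rightarrow> real) \<Rightarrow> bool" where
  "dominated \<kappa> U J g m \<longleftrightarrow>
     (AE \<tau> in lebesgue_on J. g \<tau> \<in> cont_space \<kappa> U) \<and>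
     (\<forall>x\<in>closure U. (\<lambda>\<tau>. g \<tau> x) \<in> borel_measurable (lebesgue_on J)) \<and>
     (AE \<tau> in lebesgue_on J. \<forall>x\<in>closure U. norm (g \<tau> x) \<le> m \<tau>) \<and>
     integrable (lebesgue_on J) m"

lemma AE_lebesgue_on_subset:
  assumes "AE \<tau> in lebesgue_on J. P \<tau>" "J' \<subseteq> J" "J \<in> sets lebesgue" "J' \<in> sets lebesgue"
  shows "AE \<tau> in lebesgue_on J'. P \<tau>"
proof -
  have "AE \<tau> in lebesgue. \<tau> \<in> J \<longrightarrow> P \<tau>"
    using assms(1,3) by (subst (asm) AE_restrict_space_iff) auto
  then have "AE \<tau> in lebesgue. \<tau> \<in> J' \<longrightarrow> P \<tau>"
    by eventually_elim (use assms(2) in auto)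
  then show ?thesis using assms(4) by (subst AE_restrict_space_iff) auto
qed

lemma integrable_lebesgue_on_subset:
  fixes m :: "'a::euclidean_space \<Rightarrow> 'b::euclidean_space"
  assumes "integrable (lebesgue_on J) m" "J' \<subseteq> J" "J \<in> sets lebesgue" "J' \<in> sets lebesgue"
  shows "integrable (lebesgue_on J') m"
  using set_integrable_subset[of lebesgue J m J'] assms
  by (simp add: set_integrable_def integrable_restrict_space)

lemma integral_lebesgue_on_if:
  fixes h :: "'a::euclidean_space \<Rightarrow> 'b::euclidean_space"
  assumes "J' \<subseteq> J" "J \<in> sets lebesgue" "J' \<in> sets lebesgue"
  shows "(LINT \<tau>|lebesgue_on J. (if \<tau> \<in> J' then h \<tau> else 0)) = (LINT \<tau>|lebesgue_on J'. h \<tau>)"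
proof -
  have "(\<lambda>\<tau>. if \<tau> \<in> J then if \<tau> \<in> J' then h \<tau> else 0 else 0) = (\<lambda>\<tau>. if \<tau> \<in> J' then h \<tau> else 0)"
    using assms(1) by (auto simp: fun_eq_iff)
  then show ?thesis
    using Lebesgue_Measure.integral_restrict_UNIV[OF assms(2), of "\<lambda>\<tau>. if \<tau> \<in> J' then h \<tau> else 0"]
      Lebesgue_Measure.integral_restrict_UNIV[OF assms(3), of h] by simp
qed

lemma integrable_lebesgue_on_if:
  fixes h :: "'a::euclidean_space \<Rightarrow> 'b::euclidean_space"
  assumes "J' \<subseteq> J" "J \<in> sets lebesgue" "J' \<in> sets lebesgue"
  shows "integrable (lebesgue_on J) (\<lambda>\<tau>. if \<tau> \<in> J' then h \<tau> else 0) \<longleftrightarrow> integrable (lebesgue_on J') h"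
proof -
  have "(\<lambda>\<tau>. if \<tau> \<in> J then if \<tau> \<in> J' then h \<tau> else 0 else 0) = (\<lambda>\<tau>. if \<tau> \<in> J' then h \<tau> else 0)"
    using assms(1) by (auto simp: fun_eq_iff)
  then show ?thesis
    using Lebesgue_Measure.integrable_restrict_UNIV[OF assms(2), of "\<lambda>\<tau>. if \<tau> \<in> J' then h \<tau> else 0"]
      Lebesgue_Measure.integrable_restrict_UNIV[OF assms(3), of h] by simp
qed

lemma borel_measurable_lebesgue_on_if:
  fixes h :: "'a::euclidean_space \<Rightarrow> 'b::euclidean_space"
  assumes "J' \<subseteq> J" "J \<in> sets lebesgue" "J' \<in> sets lebesgue" "h \<in> borel_measurable (lebesgue_on J')"
  shows "(\<lambda>\<tau>. if \<tau> \<in> J' then h \<tau> else 0) \<in> borel_measurable (lebesgue_on J)"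
proof -
  have "(\<lambda>\<tau>. if \<tau> \<in> J then if \<tau> \<in> J' then h \<tau> else 0 else 0) = (\<lambda>\<tau>. if \<tau> \<in> J' then h \<tau> else 0)"
    using assms(1) by (auto simp: fun_eq_iff)
  then show ?thesis
    using borel_measurable_if[OF assms(2), of "\<lambda>\<tau>. if \<tau> \<in> J' then h \<tau> else 0"]
      borel_measurable_if[OF assms(3), of h] assms(4) by simp
qed

lemma borel_measurable_lebesgue_on_subset:
  fixes h :: "'a::euclidean_space \<Rightarrow> 'b::euclidean_space"
  assumes "h \<in> borel_measurable (lebesgue_on J)" "J' \<subseteq> J"
  shows "h \<in> borel_measurable (lebesgue_on J')"
  by (rule measurable_restrict_mono[OF assms])

lemma dominated_subset:
  assumes "dominated \<kappa> U J g m" "J' \<subseteq> J" "J \<in> sets lebesgue" "J' \<in> sets lebesgue"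
  shows "dominated \<kappa> U J' g m"
  using assms(1) AE_lebesgue_on_subset[OF _ assms(2-4)] integrable_lebesgue_on_subset[OF _ assms(2-4)]
    borel_measurable_lebesgue_on_subset[OF _ assms(2)]
  unfolding dominated_def by blast

text \<open>The integral term of the variation of constants formula, taken separately at each point;
  \<open>has_X_integral_duhamel\<close> identifies it with the Bochner integral in
  \<open>X\<close>.\<close>

definition duhamel ::
  "(real \<Rightarrow> (real^'m \<Rightarrow> real^'n) \<Rightarrow> (real^'m \<Rightarrow> real^'n)) \<Rightarrow> (real \<Rightarrow> real^'m \<Rightarrow> real^'n)
     \<Rightarrow> real \<Rightarrow> real^'m \<Rightarrow> real^'n" where
  "duhamel S g t x = (LINT \<tau>|lebesgue_on {0..t}. S (t - \<tau>) (g \<tau>) x)"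

text \<open>The indefinite integral is continuous on a compact interval, hence uniformly continuous.
  This gives one length that works wherever the short interval lies, as the uniqueness argument
  requires.\<close>

lemma small_integrals:
  fixes l :: "real \<Rightarrow> real"
  assumes l: "integrable (lebesgue_on {0..\<delta>}) l" and e: "0 < e"
  obtains \<eta> where "0 < \<eta>"
    "\<And>a b. 0 \<le> a \<Longrightarrow> a \<le> b \<Longrightarrow> b \<le> \<delta> \<Longrightarrow> b - a \<le> \<eta> \<Longrightarrow> (LINT \<tau>|lebesgue_on {a..b}. l \<tau>) < e"
proof -
  have l_on: "l integrable_on {0..\<delta>}"
    using integrable_on_lebesgue_on[OF l] by simp
  have "uniformly_continuous_on {0..\<delta>} (\<lambda>t. integral {0..t} l)"
    by (intro compact_uniformly_continuous indefinite_integral_continuous_1 l_on) simp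
  then obtain d where d: "0 < d" "\<And>a b. a \<in> {0..\<delta>} \<Longrightarrow> b \<in> {0..\<delta>} \<Longrightarrow> dist b a < d \<Longrightarrow>
      dist (integral {0..b} l) (integral {0..a} l) < e"
    unfolding uniformly_continuous_on_def using e by metis
  show thesis
  proof
    \<comment> \<open>Halving turns the weak inequality on \<open>b - a\<close> into the strict one
      demanded by uniform continuity.\<close>
    show "0 < d / 2" using d by simp
    fix a b assume ab: "0 \<le> a" "a \<le> b" "b \<le> \<delta>" "b - a \<le> d / 2"
    have "integral {0..a} l + integral {a..b} l = integral {0..b} l"
      using ab by (intro Henstock_Kurzweil_Integration.integral_combine integrable_on_subinterval[OF l_on]) auto
    moreover have "dist (integral {0..b} l) (integral {0..a} l) < e"
      using ab d(1) by (intro d(2)) (auto simp: dist_real_def)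
    moreover have "(LINT \<tau>|lebesgue_on {a..b}. l \<tau>) = integral {a..b} l"
      using ab by (intro lebesgue_integral_eq_integral integrable_lebesgue_on_subset[OF l]) auto
    ultimately show "(LINT \<tau>|lebesgue_on {a..b}. l \<tau>) < e" by (simp add: dist_real_def)
  qed
qed

section \<open>Paths as jointly continuous functions\<close>

text \<open>Compactness of \<open>{0..\<delta>} \<times> closure U\<close> makes a jointly
  continuous function uniformly continuous, so that its increments in time are small uniformly in
  space. In the joint form, uniform limits and dominated convergence apply directly.\<close>

lemma path_space_iff:
  fixes u :: "real \<Rightarrow> real^'m \<Rightarrow> real^'n"
  assumes U: "U \<noteq> {}" "bounded U"
  shows "u \<in> path_space \<kappa> U \<delta> \<longleftrightarrow> u \<in> {0..\<delta>} \<rightarrow>\<^sub>E cont_space \<kappa> U \<and>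
    continuous_on ({0..\<delta>} \<times> closure U) (\<lambda>(t, x). u t x)"
proof (cases "u \<in> {0..\<delta>} \<rightarrow>\<^sub>E cont_space \<kappa> U")
  case False then show ?thesis by (simp add: path_space_def)
next
  case uE: True
  then have u: "u t \<in> cont_space \<kappa> U" if "t \<in> {0..\<delta>}" for t using that by auto
  define N where "N s t = X_norm U (\<lambda>x. u t x - u s x)" for s t
  have "(\<forall>s\<in>{0..\<delta>}. (N s \<longlongrightarrow> 0) (at s within {0..\<delta>})) \<longleftrightarrow>
    continuous_on ({0..\<delta>} \<times> closure U) (\<lambda>(t, x). u t x)" (is "?L \<longleftrightarrow> ?R")
  proof
    assume lim: ?L
    show ?R
    proof (rule continuous_on_sequentiallyI)
      fix p :: "nat \<Rightarrow> real \<times> (real^'m)" and q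
      assume p: "\<forall>n. p n \<in> {0..\<delta>} \<times> closure U" and q: "q \<in> {0..\<delta>} \<times> closure U" and pq: "p \<longlonglongrightarrow> q"
      have p1: "fst (p n) \<in> {0..\<delta>}" "snd (p n) \<in> closure U" for n
        using p by (metis mem_Times_iff)+
      have q1: "fst q \<in> {0..\<delta>}" "snd q \<in> closure U"
        using q by (metis mem_Times_iff)+
      have N0: "N (fst q) (fst q) = 0" using U(1) by (simp add: N_def X_norm_def)
      have "continuous (at (fst q) within {0..\<delta>}) (N (fst q))"
        unfolding continuous_within N0 using lim q1 by blast
      from continuous_within_tendsto_compose'[OF this p1(1) tendsto_fst[OF pq]]
      have 1: "(\<lambda>n. N (fst q) (fst (p n))) \<longlonglongrightarrow> 0" by (simp add: N0)
      have "continuous_on (closure U) (u (fst q))"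
        using u[OF q1(1)] by (simp add: cont_space_def)
      then have 2: "(\<lambda>n. u (fst q) (snd (p n))) \<longlonglongrightarrow> u (fst q) (snd q)"
        by (rule continuous_on_tendsto_compose) (use p1 q1 pq in \<open>auto intro: tendsto_snd\<close>)
      have "(\<lambda>n. u (fst (p n)) (snd (p n)) - u (fst q) (snd (p n))) \<longlonglongrightarrow> 0"
        by (rule Lim_null_comparison[OF _ 1])
          (simp add: N_def norm_le_X_norm[OF U(2) cont_space_diff[OF u[OF p1(1)] u[OF q1(1)]] p1(2)])
      from tendsto_add[OF this 2]
      show "(\<lambda>n. case p n of (t, x) \<Rightarrow> u t x) \<longlonglongrightarrow> (case q of (t, x) \<Rightarrow> u t x)"
        by (simp add: split_beta')
    qed
  next
    assume ?R
    then have unif: "uniformly_continuous_on ({0..\<delta>} \<times> closure U) (\<lambda>(t, x). u t x)"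
      using U(2) by (intro compact_uniformly_continuous compact_Times) (simp_all add: compact_closure)
    show ?L
    proof (intro ballI tendstoI)
      fix s e :: real assume s: "s \<in> {0..\<delta>}" and e: "0 < e"
      \<comment> \<open>The dimension factor compensates the passage to \<open>norm1\<close>, and
        the 2 makes the final inequality strict.\<close>
      have e': "0 < e / (2 * real CARD('n))" using e by simp
      with unif obtain d where d: "0 < d"
        "\<And>p q. p \<in> {0..\<delta>} \<times> closure U \<Longrightarrow> q \<in> {0..\<delta>} \<times> closure U \<Longrightarrow> dist q p < d \<Longrightarrow>
          dist (case q of (t, x) \<Rightarrow> u t x) (case p of (t, x) \<Rightarrow> u t x) < e / (2 * real CARD('n))"
        unfolding uniformly_continuous_on_def by metis
      have "dist (N s t) 0 < e" if t: "t \<in> {0..\<delta>}" "dist t s < d" for t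
      proof -
        have "N s t \<le> real CARD('n) * (e / (2 * real CARD('n)))"
          unfolding N_def
        proof (rule X_norm_le_norm[OF U(1)])
          fix x assume "x \<in> closure U"
          with d(2)[of "(s, x)" "(t, x)"] s t
          show "norm (u t x - u s x) \<le> e / (2 * real CARD('n))"
            by (simp add: dist_Pair_Pair dist_norm less_imp_le)
        qed
        moreover have "0 \<le> N s t"
          unfolding N_def by (rule X_norm_nonneg[OF U cont_space_diff[OF u[OF t(1)] u[OF s]]])
        ultimately show ?thesis using e by simp
      qed
      then show "\<forall>\<^sub>F t in at s within {0..\<delta>}. dist (N s t) 0 < e"
        using d(1) unfolding eventually_at by blast
    qed
  qed
  then show ?thesis using uE by (simp add: path_space_def N_def[abs_def])
qed

lemma path_space_bounded:
  fixes u :: "real \<Rightarrow> real^'m \<Rightarrow> real^'n"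
  assumes U: "U \<noteq> {}" "bounded U" and u: "u \<in> path_space \<kappa> U \<delta>"
  shows "\<exists>R. \<forall>t\<in>{0..\<delta>}. \<forall>x\<in>closure U. norm (u t x) \<le> R"
proof -
  have "compact ((\<lambda>(t, x). u t x) ` ({0..\<delta>} \<times> closure U))"
    using u[unfolded path_space_iff[OF U]] U(2)
    by (intro compact_continuous_image compact_Times) (simp_all add: compact_closure)
  then obtain R where "\<forall>y\<in>(\<lambda>(t, x). u t x) ` ({0..\<delta>} \<times> closure U). norm y \<le> R"
    using compact_imp_bounded bounded_iff by blast
  then show ?thesis by (intro exI[of _ R]) force
qed

section \<open>The variation of constants formula\<close>

context bounded_evolution
begin

text \<open>Membership in the domain is asked only eventually: in \<open>duhamel_continuous\<close>
  the times \<open>fst (p n) - \<tau>\<close> may be negative for the first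
  \<open>n\<close>.\<close>

lemma S_tendsto:
  assumes "z \<in> cont_space \<kappa> U" "t \<longlonglongrightarrow> t'" "p \<longlonglongrightarrow> p'"
    and "\<forall>\<^sub>F n in sequentially. 0 \<le> t n \<and> p n \<in> closure U" "0 \<le> t'" "p' \<in> closure U"
  shows "(\<lambda>n. S (t n) z (p n)) \<longlonglongrightarrow> S t' z p'"
proof -
  have "(\<lambda>n. (\<lambda>(t, x). S t z x) (t n, p n)) \<longlonglongrightarrow> (\<lambda>(t, x). S t z x) (t', p')"
    by (rule continuous_on_tendsto_compose[OF S_cont[OF assms(1)] tendsto_Pair[OF assms(2,3)]])
      (use assms(4-6) in auto)
  then show ?thesis by simp
qed

text \<open>The value at \<open>x\<close> depends on the whole function \<open>g \<tau>\<close>, so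
  measurable evaluations of \<open>g\<close> do not suffice directly. For a fixed \<open>v\<close>
  the map \<open>\<tau> \<mapsto> S (t - \<tau>) v x\<close> is continuous; a simple
  \<open>g\<close> glues such maps along its level sets, and the uniform bound \<open>C\<close>
  allows the passage to the limit.\<close>

lemma evolution_measurable:
  assumes g: "AE \<tau> in lebesgue_on {0..t}. g \<tau> \<in> cont_space \<kappa> U"
    and g_meas: "\<And>x. x \<in> closure U \<Longrightarrow> (\<lambda>\<tau>. g \<tau> x) \<in> borel_measurable (lebesgue_on {0..t})"
    and x: "x \<in> closure U"
  shows "(\<lambda>\<tau>. S (t - \<tau>) (g \<tau>) x) \<in> borel_measurable (lebesgue_on {0..t})"
proof -
  let ?M = "lebesgue_on {0..t}"
  have J: "{0..t} \<in> sets lebesgue" by simp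
  obtain g' where g': "\<And>\<tau>. g' \<tau> \<in> cont_space \<kappa> U" and eq: "AE \<tau> in ?M. g' \<tau> = g \<tau>"
    and g'_meas: "\<And>x. x \<in> closure U \<Longrightarrow> (\<lambda>\<tau>. g' \<tau> x) \<in> borel_measurable ?M"
    using AE_cont_space_modification[OF J g g_meas] by blast
  obtain s where s: "\<And>n::nat. simple_function ?M (s n)" "\<And>n \<tau>. s n \<tau> \<in> cont_space \<kappa> U"
    "\<And>n. (\<lambda>\<tau>. X_norm U (\<lambda>x. g' \<tau> x - s n \<tau> x)) \<in> borel_measurable ?M"
    "\<And>n \<tau>. \<tau> \<in> space ?M \<Longrightarrow> X_norm U (\<lambda>x. g' \<tau> x - s n \<tau> x) \<le> X_norm U (g' \<tau>)"
    "\<And>\<tau>. \<tau> \<in> space ?M \<Longrightarrow> (\<lambda>n. X_norm U (\<lambda>x. g' \<tau> x - s n \<tau> x)) \<longlonglongrightarrow> 0"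
    using simple_approximation[OF U g' g'_meas] by blast
  have "(\<lambda>\<tau>. S (t - \<tau>) (s n \<tau>) x) \<in> borel_measurable ?M" for n
  proof (rule measurable_compose_countable'[where g="s n" and I="s n ` {0..t}"])
    fix v assume "v \<in> s n ` {0..t}"
    then have v: "v \<in> cont_space \<kappa> U" using s(2) by auto
    have "continuous_on {0..t} (\<lambda>\<tau>. (\<lambda>(t, x). S t v x) (t - \<tau>, x))"
      by (rule continuous_on_compose2[OF S_cont[OF v]]) (auto intro!: continuous_intros simp: x)
    then show "(\<lambda>\<tau>. S (t - \<tau>) v x) \<in> borel_measurable ?M"
      by (intro continuous_imp_measurable_on_sets_lebesgue) auto
  next
    show "s n \<in> ?M \<rightarrow>\<^sub>M count_space (s n ` {0..t})"
      using simple_functionD[OF s(1)[of n]] by (subst measurable_count_space_eq2) auto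
    show "countable (s n ` {0..t})"
      using simple_functionD(1)[OF s(1)[of n]] by (simp add: countable_finite)
  qed
  moreover have "(\<lambda>n. S (t - \<tau>) (s n \<tau>) x) \<longlonglongrightarrow> S (t - \<tau>) (g' \<tau>) x" if \<tau>: "\<tau> \<in> space ?M" for \<tau>
  proof -
    have lim: "(\<lambda>n. C * X_norm U (\<lambda>x. g' \<tau> x - s n \<tau> x)) \<longlonglongrightarrow> 0"
      using tendsto_mult_right_zero[OF s(5)[OF \<tau>]] by simp
    have "norm (S (t - \<tau>) (\<lambda>x. g' \<tau> x - s n \<tau> x) x) \<le> C * X_norm U (\<lambda>x. g' \<tau> x - s n \<tau> x)" for n
      using \<tau> x norm_le_X_norm[OF U(2) cont_space_diff[OF g' s(2)]]
      by (intro S_bound cont_space_diff[OF g' s(2)]) auto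
    then have "(\<lambda>n. S (t - \<tau>) (g' \<tau>) x - S (t - \<tau>) (s n \<tau>) x) \<longlonglongrightarrow> 0"
      using \<tau> by (intro Lim_null_comparison[OF _ lim]) (auto simp: S_diff g' s(2))
    from tendsto_diff[OF tendsto_const[of "S (t - \<tau>) (g' \<tau>) x"] this] show ?thesis by simp
  qed
  ultimately have "(\<lambda>\<tau>. S (t - \<tau>) (g' \<tau>) x) \<in> borel_measurable ?M"
    by (rule borel_measurable_LIMSEQ_metric)
  then show ?thesis
    by (rule borel_measurable_lebesgue_on_AE[rotated]) (use eq in \<open>auto elim: eventually_mono\<close>)
qed

lemma dominated_evolution:
  assumes "dominated \<kappa> U {0..t} g m"
  shows "dominated \<kappa> U {0..t} (\<lambda>\<tau>. S (t - \<tau>) (g \<tau>)) (\<lambda>\<tau>. C * m \<tau>)"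
  unfolding dominated_def
proof (intro conjI ballI)
  let ?M = "lebesgue_on {0..t}"
  from assms have g: "AE \<tau> in ?M. g \<tau> \<in> cont_space \<kappa> U"
    and g_meas: "\<And>x. x \<in> closure U \<Longrightarrow> (\<lambda>\<tau>. g \<tau> x) \<in> borel_measurable ?M"
    and bound: "AE \<tau> in ?M. \<forall>x\<in>closure U. norm (g \<tau> x) \<le> m \<tau>"
    and m: "integrable ?M m"
    unfolding dominated_def by auto
  show "integrable ?M (\<lambda>\<tau>. C * m \<tau>)" using m by simp
  show "AE \<tau> in ?M. S (t - \<tau>) (g \<tau>) \<in> cont_space \<kappa> U"
    using g AE_space by eventually_elim (auto intro: S_mem)
  show "AE \<tau> in ?M. \<forall>x\<in>closure U. norm (S (t - \<tau>) (g \<tau>) x) \<le> C * m \<tau>"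
    using g bound AE_space by eventually_elim (auto intro!: S_bound)
  show "(\<lambda>\<tau>. S (t - \<tau>) (g \<tau>) x) \<in> borel_measurable ?M" if "x \<in> closure U" for x
    using g g_meas that by (rule evolution_measurable)
qed

lemma has_X_integral_duhamel:
  assumes "dominated \<kappa> U {0..t} g m"
  shows "has_X_integral \<kappa> U {0..t} (\<lambda>\<tau>. S (t - \<tau>) (g \<tau>)) (duhamel S g t)"
proof -
  have "has_X_integral \<kappa> U {0..t} (\<lambda>\<tau>. S (t - \<tau>) (g \<tau>))
      (\<lambda>x. LINT \<tau>|lebesgue_on {0..t}. S (t - \<tau>) (g \<tau>) x)"
    using dominated_evolution[OF assms] unfolding dominated_def
    by (intro has_X_integralI[OF U, where g="\<lambda>\<tau>. C * m \<tau>"]) auto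
  then show ?thesis by (simp add: duhamel_def[abs_def])
qed

lemma integrable_evolution:
  assumes "dominated \<kappa> U {0..t} g m" "x \<in> closure U"
  shows "integrable (lebesgue_on {0..t}) (\<lambda>\<tau>. S (t - \<tau>) (g \<tau>) x)"
proof (rule Bochner_Integration.integrable_bound)
  note d = dominated_evolution[OF assms(1), unfolded dominated_def]
  from d show "integrable (lebesgue_on {0..t}) (\<lambda>\<tau>. C * m \<tau>)" by blast
  from d assms(2) show "(\<lambda>\<tau>. S (t - \<tau>) (g \<tau>) x) \<in> borel_measurable (lebesgue_on {0..t})" by blast
  from d have "AE \<tau> in lebesgue_on {0..t}. \<forall>x\<in>closure U. norm (S (t - \<tau>) (g \<tau>) x) \<le> C * m \<tau>" by blast
  then show "AE \<tau> in lebesgue_on {0..t}. norm (S (t - \<tau>) (g \<tau>) x) \<le> norm (C * m \<tau>)"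
    by eventually_elim (use assms(2) in \<open>auto intro: order_trans[OF _ abs_ge_self]\<close>)
qed

text \<open>\<open>m1\<close> and \<open>m2\<close> make the two integrals exist, while
  \<open>m\<close> governs the size of the difference. Linearity of the semigroup moves the
  difference under the evolution.\<close>

lemma duhamel_diff_bound:
  assumes g: "dominated \<kappa> U {0..t} g m1" and h: "dominated \<kappa> U {0..t} h m2"
    and m: "integrable (lebesgue_on {0..t}) m"
    and bound: "AE \<tau> in lebesgue_on {0..t}. \<forall>x\<in>closure U. norm (g \<tau> x - h \<tau> x) \<le> m \<tau>"
    and x: "x \<in> closure U"
  shows "norm (duhamel S g t x - duhamel S h t x) \<le> C * (LINT \<tau>|lebesgue_on {0..t}. m \<tau>)"
proof -
  let ?M = "lebesgue_on {0..t}"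
  have gX: "AE \<tau> in ?M. g \<tau> \<in> cont_space \<kappa> U" and hX: "AE \<tau> in ?M. h \<tau> \<in> cont_space \<kappa> U"
    using g h unfolding dominated_def by auto
  have "duhamel S g t x - duhamel S h t x = (LINT \<tau>|?M. S (t - \<tau>) (g \<tau>) x - S (t - \<tau>) (h \<tau>) x)"
    unfolding duhamel_def using integrable_evolution[OF g x] integrable_evolution[OF h x] by simp
  also have "norm \<dots> \<le> (LINT \<tau>|?M. C * m \<tau>)"
  proof (rule norm_integral_le_AE)
    show "AE \<tau> in ?M. norm (S (t - \<tau>) (g \<tau>) x - S (t - \<tau>) (h \<tau>) x) \<le> C * m \<tau>"
      using gX hX bound AE_space
    proof eventually_elim
      case (elim \<tau>)
      then have "norm (S (t - \<tau>) (\<lambda>x. g \<tau> x - h \<tau> x) x) \<le> C * m \<tau>"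
        using x by (intro S_bound cont_space_diff) auto
      then show ?case using elim by (simp add: S_diff)
    qed
  qed (use m integrable_evolution[OF g x] integrable_evolution[OF h x] in auto)
  finally show ?thesis by simp
qed

lemma duhamel_bound:
  assumes g: "dominated \<kappa> U {0..t} g m" and x: "x \<in> closure U"
  shows "norm (duhamel S g t x) \<le> C * (LINT \<tau>|lebesgue_on {0..t}. m \<tau>)"
proof -
  have "norm (duhamel S g t x) \<le> (LINT \<tau>|lebesgue_on {0..t}. C * m \<tau>)"
    unfolding duhamel_def
    using integrable_evolution[OF g x] dominated_evolution[OF g, unfolded dominated_def] x
    by (intro norm_integral_le_AE) (auto elim: eventually_mono)
  then show ?thesis by simp
qed

lemma duhamel_continuous:
  assumes g: "dominated \<kappa> U {0..\<delta>} g m"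
  shows "continuous_on ({0..\<delta>} \<times> closure U) (\<lambda>(t, x). duhamel S g t x)"
proof (rule continuous_on_sequentiallyI)
  let ?M = "lebesgue_on {0..\<delta>}"
  fix p :: "nat \<Rightarrow> real \<times> (real^'m)" and q
  assume "\<forall>n. p n \<in> {0..\<delta>} \<times> closure U" and "q \<in> {0..\<delta>} \<times> closure U" and pq: "p \<longlonglongrightarrow> q"
  then have p: "fst (p n) \<in> {0..\<delta>}" "snd (p n) \<in> closure U"
    and q: "fst q \<in> {0..\<delta>}" "snd q \<in> closure U" for n
    by (metis mem_Times_iff)+
  \<comment> \<open>Extending the integrand by \<open>0\<close> makes the domain of integration independent of \<open>t\<close>; the
    extension converges except at \<open>\<tau> = fst q\<close>, where it jumps.\<close>
  define H where "H r = (\<lambda>\<tau>. if \<tau> \<in> {0..fst r} then S (fst r - \<tau>) (g \<tau>) (snd r) else 0)"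
    for r :: "real \<times> (real^'m)"
  have sub: "dominated \<kappa> U {0..t} g m" if "t \<in> {0..\<delta>}" for t
    using that by (intro dominated_subset[OF g]) auto
  have H_int: "(LINT \<tau>|?M. H r \<tau>) = duhamel S g (fst r) (snd r)" if "fst r \<in> {0..\<delta>}" for r
    unfolding H_def duhamel_def by (rule integral_lebesgue_on_if) (use that in auto)
  have H_meas: "H r \<in> borel_measurable ?M" if "fst r \<in> {0..\<delta>}" "snd r \<in> closure U" for r
    unfolding H_def using integrable_evolution[OF sub that(2)] that
    by (intro borel_measurable_lebesgue_on_if) auto
  have gX: "AE \<tau> in ?M. g \<tau> \<in> cont_space \<kappa> U"
    and bound: "AE \<tau> in ?M. \<forall>x\<in>closure U. norm (g \<tau> x) \<le> m \<tau>" and m: "integrable ?M m"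
    using g unfolding dominated_def by auto
  have "(\<lambda>n. LINT \<tau>|?M. H (p n) \<tau>) \<longlonglongrightarrow> (LINT \<tau>|?M. H q \<tau>)"
  \<comment> \<open>The absolute value makes the majorant nonnegative also where \<open>H\<close> is
    the extension by 0.\<close>
  proof (rule integral_dominated_convergence[where w="\<lambda>\<tau>. C * norm (m \<tau>)"])
    show "AE \<tau> in ?M. norm (H (p n) \<tau>) \<le> C * norm (m \<tau>)" for n
      using gX bound
    proof eventually_elim
      case (elim \<tau>)
      have "norm (S (fst (p n) - \<tau>) (g \<tau>) (snd (p n))) \<le> C * norm (m \<tau>)" if "\<tau> \<le> fst (p n)"
        by (rule S_bound) (use that elim p in \<open>auto intro: order_trans[OF _ abs_ge_self]\<close>)
      then show ?case using C_pos by (auto simp: H_def)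
    qed
    have "AE \<tau> in lebesgue. \<tau> \<noteq> fst q"
      using AE_lborel_singleton by (rule AE_completion)
    then have "AE \<tau> in ?M. \<tau> \<noteq> fst q"
      by (subst AE_restrict_space_iff) (auto elim: eventually_mono)
    then show "AE \<tau> in ?M. (\<lambda>n. H (p n) \<tau>) \<longlonglongrightarrow> H q \<tau>"
      using gX AE_space
    proof eventually_elim
      case (elim \<tau>)
      have lim: "(\<lambda>n. fst (p n)) \<longlonglongrightarrow> fst q" "(\<lambda>n. snd (p n)) \<longlonglongrightarrow> snd q"
        using pq by (auto intro: tendsto_fst tendsto_snd)
      show ?case
      proof (cases "\<tau> < fst q")
        case True
        then have ev: "\<forall>\<^sub>F n in sequentially. \<tau> < fst (p n)"
          using lim(1) order_tendstoD(1) by blast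
        have "(\<lambda>n. S (fst (p n) - \<tau>) (g \<tau>) (snd (p n))) \<longlonglongrightarrow> S (fst q - \<tau>) (g \<tau>) (snd q)"
          using elim True p q eventually_mono[OF ev]
          by (intro S_tendsto tendsto_intros lim) (auto elim: eventually_mono[OF ev])
        moreover have "\<forall>\<^sub>F n in sequentially. S (fst (p n) - \<tau>) (g \<tau>) (snd (p n)) = H (p n) \<tau>"
          using ev by eventually_elim (use elim in \<open>auto simp: H_def\<close>)
        ultimately have "(\<lambda>n. H (p n) \<tau>) \<longlonglongrightarrow> S (fst q - \<tau>) (g \<tau>) (snd q)"
          by (rule Lim_transform_eventually)
        then show ?thesis using True elim by (simp add: H_def)
      next
        case False
        then have "fst q < \<tau>" using elim by simp
        then have ev: "\<forall>\<^sub>F n in sequentially. fst (p n) < \<tau>"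
          using lim(1) order_tendstoD(2) by blast
        have "\<forall>\<^sub>F n in sequentially. H (p n) \<tau> = 0"
          using ev by eventually_elim (auto simp: H_def)
        then show ?thesis using \<open>fst q < \<tau>\<close> by (auto simp: H_def tendsto_eventually)
      qed
    qed
  qed (use H_meas p q m in auto)
  then show "(\<lambda>n. case p n of (t, x) \<Rightarrow> duhamel S g t x) \<longlonglongrightarrow> (case q of (t, x) \<Rightarrow> duhamel S g t x)"
    using H_int p q by (simp add: split_beta')
qed

text \<open>The self-map property behind the fixed point argument: membership in \<open>X\<close> at
  each time is part of the Bochner integral, and joint continuity comes from dominated
  convergence.\<close>

lemma mild_path:
  assumes g: "dominated \<kappa> U {0..\<delta>} g m" and z: "z \<in> cont_space \<kappa> U"
  shows "(\<lambda>t\<in>{0..\<delta>}. \<lambda>x. S t z x + duhamel S g t x) \<in> path_space \<kappa> U \<delta>"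
  unfolding path_space_iff[OF U]
proof
  have "duhamel S g t \<in> cont_space \<kappa> U" if "t \<in> {0..\<delta>}" for t
    using has_X_integral_duhamel[OF dominated_subset[OF g]] that unfolding has_X_integral_def by auto
  then show "(\<lambda>t\<in>{0..\<delta>}. \<lambda>x. S t z x + duhamel S g t x) \<in> {0..\<delta>} \<rightarrow>\<^sub>E cont_space \<kappa> U"
    using z by (auto intro!: cont_space_add S_mem)
  have "continuous_on ({0..\<delta>} \<times> closure U) (\<lambda>p. (\<lambda>(t, x). S t z x) p + (\<lambda>(t, x). duhamel S g t x) p)"
    by (intro continuous_on_add duhamel_continuous[OF g] continuous_on_subset[OF S_cont[OF z]]) auto
  then show "continuous_on ({0..\<delta>} \<times> closure U)
      (\<lambda>(t, x). (\<lambda>t\<in>{0..\<delta>}. \<lambda>x. S t z x + duhamel S g t x) t x)"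
    by (rule continuous_on_eq) auto
qed

end

section \<open>Local existence and uniqueness\<close>

text \<open>A form of Banach's principle for a set \<open>B\<close> whose elements are compared only
  through their values \<open>ev u p\<close> for \<open>p\<close> in \<open>A\<close>. A common
  bound \<open>e\<close> replaces the distance, so no supremum is formed, and the fixed point
  equation is obtained on \<open>A\<close> only.\<close>

lemma contraction_fixpoint:
  fixes ev :: "'c \<Rightarrow> 'a \<Rightarrow> 'b::banach"
  assumes w0: "w0 \<in> B" and maps: "\<And>u. u \<in> B \<Longrightarrow> \<Phi> u \<in> B"
    and contr: "\<And>u v e p. u \<in> B \<Longrightarrow> v \<in> B \<Longrightarrow> (\<And>p. p \<in> A \<Longrightarrow> norm (ev u p - ev v p) \<le> e) \<Longrightarrow>
      p \<in> A \<Longrightarrow> norm (ev (\<Phi> u) p - ev (\<Phi> v) p) \<le> e / 2"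
    and bdd: "\<And>u p. u \<in> B \<Longrightarrow> p \<in> A \<Longrightarrow> norm (ev u p) \<le> R"
    and closed: "\<And>w h. (\<And>n::nat. w n \<in> B) \<Longrightarrow> uniform_limit A (\<lambda>n. ev (w n)) h sequentially \<Longrightarrow>
      \<exists>u\<in>B. \<forall>p\<in>A. ev u p = h p"
  obtains u where "u \<in> B" "\<And>p. p \<in> A \<Longrightarrow> ev (\<Phi> u) p = ev u p"
proof -
  define w where "w n = (\<Phi> ^^ n) w0" for n
  have w: "w n \<in> B" for n unfolding w_def by (induction n) (auto simp: w0 maps)
  have w_Suc: "w (Suc n) = \<Phi> (w n)" for n by (simp add: w_def)
  \<comment> \<open>Comparing \<open>w n\<close> with an arbitrary later iterate gives the Cauchy
    estimate without summing a geometric series. The induction starts from \<open>2 * R\<close>,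
    which bounds the difference of any two elements of \<open>B\<close>.\<close>
  have w_diff: "norm (ev (w (n + k)) p - ev (w n) p) \<le> 2 * R / 2 ^ n" if "p \<in> A" for n k p
    using that
  proof (induction n arbitrary: p)
    case 0
    then have "norm (ev (w (0 + k)) p - ev (w 0) p) \<le> R + R"
      by (intro order_trans[OF norm_triangle_ineq4] add_mono bdd w)
    then show ?case by simp
  next
    case (Suc n)
    have "norm (ev (\<Phi> (w (n + k))) p - ev (\<Phi> (w n)) p) \<le> 2 * R / 2 ^ n / 2"
      by (rule contr[OF w w _ Suc.prems]) (rule Suc.IH)
    then show ?case by (simp add: w_Suc)
  qed
  have "uniformly_Cauchy_on A (\<lambda>n. ev (w n))"
  proof (rule uniformly_Cauchy_onI')
    fix e :: real assume e: "0 < e"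
    have "(\<lambda>n. 2 * R * (1 / 2) ^ n) \<longlonglongrightarrow> 2 * R * 0"
      by (intro tendsto_intros LIMSEQ_power_zero) simp
    then have "\<forall>\<^sub>F n in sequentially. 2 * R * (1 / 2) ^ n < e"
      using e by (auto dest: order_tendstoD(2))
    then obtain M where M: "\<And>n. n \<ge> M \<Longrightarrow> 2 * R / 2 ^ n < e"
      by (auto simp: eventually_sequentially power_one_over)
    show "\<exists>M. \<forall>p\<in>A. \<forall>m\<ge>M. \<forall>n>m. dist (ev (w m) p) (ev (w n) p) < e"
    proof (intro exI[of _ M] ballI allI impI)
      fix p m n assume "p \<in> A" "M \<le> m" "m < n"
      then show "dist (ev (w m) p) (ev (w n) p) < e"
        using w_diff[of p m "n - m"] M[of m] by (simp add: dist_norm norm_minus_commute)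
    qed
  qed
  then obtain h where h: "uniform_limit A (\<lambda>n. ev (w n)) h sequentially"
    using Cauchy_uniformly_convergent uniformly_convergent_on_def by blast
  from closed[OF w this] obtain u where u: "u \<in> B" "\<And>p. p \<in> A \<Longrightarrow> ev u p = h p" by blast
  show thesis
  proof
    fix p assume p: "p \<in> A"
    \<comment> \<open>The contraction property carries the convergence of \<open>w n\<close> to
      \<open>u\<close> over to that of \<open>w (Suc n)\<close> to \<open>\<Phi> u\<close>; the
      shifted sequence then has two limits.\<close>
    have "(\<lambda>n. ev (w (Suc n)) p) \<longlonglongrightarrow> ev (\<Phi> u) p"
    proof (rule tendstoI)
      fix e :: real assume e: "0 < e"
      show "\<forall>\<^sub>F n in sequentially. dist (ev (w (Suc n)) p) (ev (\<Phi> u) p) < e"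
        using uniform_limitD[OF h e]
      proof eventually_elim
        case (elim n)
        then have "norm (ev (w n) q - ev u q) \<le> e" if "q \<in> A" for q
          using that u(2) by (simp add: dist_norm less_imp_le)
        from contr[OF w u(1) this p] e show ?case by (simp add: w_Suc dist_norm)
      qed
    qed
    moreover have "(\<lambda>n. ev (w (Suc n)) p) \<longlonglongrightarrow> ev u p"
      using LIMSEQ_Suc[OF tendsto_uniform_limitI[OF h p]] u(2)[OF p] by simp
    ultimately show "ev (\<Phi> u) p = ev u p" by (rule LIMSEQ_unique)
  qed (rule u(1))
qed

section \<open>The nonlinear forcing term\<close>

lemma AE_lebesgue_imp_lebesgue_on:
  assumes "AE \<tau> in lebesgue. P \<tau>" "J \<in> sets lebesgue"
  shows "AE \<tau> in lebesgue_on J. P \<tau>"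
  using assms by (subst AE_restrict_space_iff) (auto elim: eventually_mono)

lemma L1_loc_integrable:
  assumes "L1_loc m" shows "integrable (lebesgue_on {a..b}) m"
  using assms unfolding L1_loc_def set_integrable_def by (subst integrable_restrict_space) auto

locale semilinear_problem = bounded_evolution \<kappa> U S C
  for \<kappa> and U :: "(real^'m) set" and S :: "real \<Rightarrow> (real^'m \<Rightarrow> real^'n) \<Rightarrow> (real^'m \<Rightarrow> real^'n)" and C +
  fixes f :: "real \<Rightarrow> real^'m \<Rightarrow> real^'n \<Rightarrow> real^'n"
  assumes f: "lipschitz_caratheodory U f"
    and f_frontier: "\<kappa> = 0 \<Longrightarrow> x \<in> frontier U \<Longrightarrow> f t x 0 = 0"
begin

abbreviation forcing :: "(real \<Rightarrow> real^'m \<Rightarrow> real^'n) \<Rightarrow> real \<Rightarrow> real^'m \<Rightarrow> real^'n" where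
  "forcing u \<equiv> \<lambda>\<tau>. nemytskii U f \<tau> (u \<tau>)"

text \<open>The exceptional null set does not depend on \<open>z\<close>, so the statement may be
  used along a path, where \<open>z\<close> varies with time. The condition on the frontier keeps
  the Dirichlet values at 0.\<close>

lemma forcing_mem:
  "AE \<tau> in lebesgue. \<forall>z\<in>cont_space \<kappa> U. nemytskii U f \<tau> z \<in> cont_space \<kappa> U"
proof -
  have "AE t in lebesgue. continuous_on (closure U \<times> UNIV) (\<lambda>(x, y). f t x y)"
    using f by (simp add: lipschitz_caratheodory_def strong_caratheodory_def)
  then show ?thesis
  proof eventually_elim
    case (elim t)
    show ?case
    proof
      fix z :: "real^'m \<Rightarrow> real^'n" assume z: "z \<in> cont_space \<kappa> U"
      have "continuous_on (closure U) (\<lambda>x. (\<lambda>(x, y). f t x y) (x, z x))"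
        using z by (intro continuous_on_compose2[OF elim] continuous_intros) (auto simp: cont_space_def)
      then have "continuous_on (closure U) (nemytskii U f t z)"
        by (rule continuous_on_eq) (simp add: nemytskii_def)
      then show "nemytskii U f t z \<in> cont_space \<kappa> U"
        using z f_frontier by (auto simp: cont_space_def nemytskii_def)
    qed
  qed
qed

text \<open>Joint Borel measurability of \<open>f\<close> is what allows composition with the
  continuous curve \<open>\<tau> \<mapsto> (\<tau>, x, u \<tau> x)\<close>.\<close>

lemma forcing_measurable:
  assumes u: "u \<in> path_space \<kappa> U \<delta>" and x: "x \<in> closure U"
  shows "(\<lambda>\<tau>. forcing u \<tau> x) \<in> borel_measurable (lebesgue_on {0..\<delta>})"
proof -
  have "continuous_on {0..\<delta>} (\<lambda>\<tau>. (\<lambda>(t, x). u t x) (\<tau>, x))"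
    by (rule continuous_on_compose2[OF conjunct2[OF u[unfolded path_space_iff[OF U]]]])
      (auto intro!: continuous_intros simp: x)
  then have "(\<lambda>\<tau>. (\<tau>, x, u \<tau> x)) \<in> borel_measurable (lebesgue_on {0..\<delta>})"
    by (intro continuous_imp_measurable_on_sets_lebesgue continuous_intros) auto
  then have "(\<lambda>\<tau>. (\<tau>, x, u \<tau> x)) \<in>
      lebesgue_on {0..\<delta>} \<rightarrow>\<^sub>M restrict_space borel (UNIV \<times> closure U \<times> UNIV)"
    using x by (intro measurable_restrict_space2) auto
  moreover have "(\<lambda>(t, x, y). f t x y) \<in> borel_measurable (restrict_space borel (UNIV \<times> closure U \<times> UNIV))"
    using f by (simp add: lipschitz_caratheodory_def strong_caratheodory_def)
  ultimately have "(\<lambda>\<tau>. (\<lambda>(t, x, y). f t x y) (\<tau>, x, u \<tau> x)) \<in> borel_measurable (lebesgue_on {0..\<delta>})"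
    by (rule measurable_compose)
  then show ?thesis using x by (simp add: nemytskii_def)
qed

text \<open>\<open>m\<close> depends on the radius \<open>R\<close> alone, neither on the path nor
  on its length, so an interval can be chosen after it.\<close>

lemma forcing_dominated:
  obtains m where "\<And>a b. integrable (lebesgue_on {a..b}) m"
    "\<And>\<delta> u. u \<in> path_space \<kappa> U \<delta> \<Longrightarrow> (\<And>t x. t \<in> {0..\<delta>} \<Longrightarrow> x \<in> closure U \<Longrightarrow> norm (u t x) \<le> R) \<Longrightarrow>
      dominated \<kappa> U {0..\<delta>} (forcing u) m"
proof -
  obtain m where m: "L1_loc m" "AE t in lebesgue. \<forall>x\<in>closure U. \<forall>y\<in>cball 0 R. norm1 (f t x y) \<le> m t"
    using f compact_cball unfolding lipschitz_caratheodory_def strong_caratheodory_def by meson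
  show thesis
  proof
    show "integrable (lebesgue_on {a..b}) m" for a b by (rule L1_loc_integrable[OF m(1)])
    fix \<delta> and u :: "real \<Rightarrow> real^'m \<Rightarrow> real^'n"
    assume u: "u \<in> path_space \<kappa> U \<delta>"
      and R: "\<And>t x. t \<in> {0..\<delta>} \<Longrightarrow> x \<in> closure U \<Longrightarrow> norm (u t x) \<le> R"
    have uX: "u t \<in> cont_space \<kappa> U" if "t \<in> {0..\<delta>}" for t
      using u that by (auto simp: path_space_def)
    show "dominated \<kappa> U {0..\<delta>} (forcing u) m"
      unfolding dominated_def
    proof (intro conjI ballI)
      have "AE \<tau> in lebesgue_on {0..\<delta>}. \<forall>z\<in>cont_space \<kappa> U. nemytskii U f \<tau> z \<in> cont_space \<kappa> U"
        by (rule AE_lebesgue_imp_lebesgue_on[OF forcing_mem]) simp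
      then show "AE \<tau> in lebesgue_on {0..\<delta>}. forcing u \<tau> \<in> cont_space \<kappa> U"
        using AE_space by eventually_elim (use uX in auto)
      have "AE t in lebesgue_on {0..\<delta>}. \<forall>x\<in>closure U. \<forall>y\<in>cball 0 R. norm1 (f t x y) \<le> m t"
        by (rule AE_lebesgue_imp_lebesgue_on[OF m(2)]) simp
      then show "AE \<tau> in lebesgue_on {0..\<delta>}. \<forall>x\<in>closure U. norm (forcing u \<tau> x) \<le> m \<tau>"
        using AE_space
      proof eventually_elim
        case (elim \<tau>)
        show ?case
        proof
          fix x assume x: "x \<in> closure U"
          have "norm (f \<tau> x (u \<tau> x)) \<le> norm1 (f \<tau> x (u \<tau> x))" by (rule norm_le_norm1)
          also have "\<dots> \<le> m \<tau>" using elim R x by simp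
          finally show "norm (forcing u \<tau> x) \<le> m \<tau>" using x by (simp add: nemytskii_def)
        qed
      qed
    qed (use forcing_measurable[OF u] L1_loc_integrable[OF m(1)] in auto)
  qed
qed

text \<open>The error \<open>e\<close> may vary in time: uniqueness inserts one that vanishes as
  long as the two solutions are known to agree. The coefficient obtained here contains the dimension
  factor from the comparison of norms.\<close>

lemma forcing_lipschitz:
  obtains l where "\<And>a b. integrable (lebesgue_on {a..b}) l"
    "\<And>\<delta> u v e. (\<And>t x. t \<in> {0..\<delta>} \<Longrightarrow> x \<in> closure U \<Longrightarrow> norm (u t x) \<le> R) \<Longrightarrow>
      (\<And>t x. t \<in> {0..\<delta>} \<Longrightarrow> x \<in> closure U \<Longrightarrow> norm (v t x) \<le> R) \<Longrightarrow>
      (\<And>t x. t \<in> {0..\<delta>} \<Longrightarrow> x \<in> closure U \<Longrightarrow> norm (u t x - v t x) \<le> e t) \<Longrightarrow>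
      AE \<tau> in lebesgue_on {0..\<delta>}. \<forall>x\<in>closure U. norm (forcing u \<tau> x - forcing v \<tau> x) \<le> l \<tau> * e \<tau>"
proof -
  let ?N = "real CARD('n)"
  obtain l where l: "L1_loc l" "\<And>t. 0 \<le> l t"
    "AE t in lebesgue. \<forall>x\<in>closure U. \<forall>y1\<in>cball 0 R. \<forall>y2\<in>cball 0 R.
       norm1 (f t x y1 - f t x y2) \<le> l t * norm1 (y1 - y2)"
    using f compact_cball unfolding lipschitz_caratheodory_def by meson
  show thesis
  proof
    show "integrable (lebesgue_on {a..b}) (\<lambda>t. l t * ?N)" for a b
      using L1_loc_integrable[OF l(1)] by simp
    fix \<delta> and u v :: "real \<Rightarrow> real^'m \<Rightarrow> real^'n" and e :: "real \<Rightarrow> real"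
    assume u: "\<And>t x. t \<in> {0..\<delta>} \<Longrightarrow> x \<in> closure U \<Longrightarrow> norm (u t x) \<le> R"
      and v: "\<And>t x. t \<in> {0..\<delta>} \<Longrightarrow> x \<in> closure U \<Longrightarrow> norm (v t x) \<le> R"
      and e: "\<And>t x. t \<in> {0..\<delta>} \<Longrightarrow> x \<in> closure U \<Longrightarrow> norm (u t x - v t x) \<le> e t"
    have "AE t in lebesgue_on {0..\<delta>}. \<forall>x\<in>closure U. \<forall>y1\<in>cball 0 R. \<forall>y2\<in>cball 0 R.
       norm1 (f t x y1 - f t x y2) \<le> l t * norm1 (y1 - y2)"
      by (rule AE_lebesgue_imp_lebesgue_on[OF l(3)]) simp
    then show "AE \<tau> in lebesgue_on {0..\<delta>}. \<forall>x\<in>closure U.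
        norm (forcing u \<tau> x - forcing v \<tau> x) \<le> l \<tau> * ?N * e \<tau>"
      using AE_space
    proof eventually_elim
      case (elim \<tau>)
      show ?case
      proof
        fix x assume x: "x \<in> closure U"
        have "norm (f \<tau> x (u \<tau> x) - f \<tau> x (v \<tau> x)) \<le> norm1 (f \<tau> x (u \<tau> x) - f \<tau> x (v \<tau> x))"
          by (rule norm_le_norm1)
        also have "\<dots> \<le> l \<tau> * norm1 (u \<tau> x - v \<tau> x)" using elim u v x by simp
        also have "\<dots> \<le> l \<tau> * (?N * e \<tau>)"
          using elim e x l(2)
          by (intro mult_left_mono order_trans[OF norm1_le_norm]) auto
        finally show "norm (forcing u \<tau> x - forcing v \<tau> x) \<le> l \<tau> * ?N * e \<tau>"
          using x by (simp add: nemytskii_def mult.assoc)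
      qed
    qed
  qed
qed

text \<open>The pointwise form of a mild solution, with \<open>z\<close> in place of
  \<open>u 0\<close>; the initial condition is recovered in \<open>solution_0\<close>.\<close>

definition solution :: "(real^'m \<Rightarrow> real^'n) \<Rightarrow> real \<Rightarrow> (real \<Rightarrow> real^'m \<Rightarrow> real^'n) \<Rightarrow> bool" where
  "solution z \<delta> u \<longleftrightarrow> u \<in> path_space \<kappa> U \<delta> \<and>
     (\<forall>t\<in>{0..\<delta>}. u t = (\<lambda>x. S t z x + duhamel S (forcing u) t x))"

lemma path_forcing_dominated:
  assumes "u \<in> path_space \<kappa> U \<delta>"
  obtains m where "dominated \<kappa> U {0..\<delta>} (forcing u) m"
proof -
  obtain R where R: "\<forall>t\<in>{0..\<delta>}. \<forall>x\<in>closure U. norm (u t x) \<le> R"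
    using path_space_bounded[OF U assms] by blast
  show thesis
  proof (rule forcing_dominated[of R])
    fix m
    assume m: "\<And>\<delta> v. v \<in> path_space \<kappa> U \<delta> \<Longrightarrow>
      (\<And>t x. t \<in> {0..\<delta>} \<Longrightarrow> x \<in> closure U \<Longrightarrow> norm (v t x) \<le> R) \<Longrightarrow>
      dominated \<kappa> U {0..\<delta>} (forcing v) m"
    show thesis by (rule that[OF m[OF assms]]) (use R in blast)
  qed
qed

text \<open>The radius splits into \<open>C * \<rho>\<close> for the evolution of \<open>z\<close>
  and 1 for the integral, the latter by \<open>m_small\<close>; \<open>l_small\<close> gives the
  contraction factor 1/2. Majorant and Lipschitz coefficient enter as hypotheses because \<delta>
  has to be chosen after them.\<close>

lemma local_existence:
  fixes z :: "real^'m \<Rightarrow> real^'n"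
  assumes z: "z \<in> cont_space \<kappa> U" and z_bound: "\<And>x. x \<in> closure U \<Longrightarrow> norm (z x) \<le> \<rho>"
    and m: "\<And>u :: real \<Rightarrow> real^'m \<Rightarrow> real^'n. u \<in> path_space \<kappa> U \<delta> \<Longrightarrow>
      (\<And>t x. t \<in> {0..\<delta>} \<Longrightarrow> x \<in> closure U \<Longrightarrow> norm (u t x) \<le> C * \<rho> + 1) \<Longrightarrow>
      dominated \<kappa> U {0..\<delta>} (forcing u) m"
    and m_small: "\<And>t. t \<in> {0..\<delta>} \<Longrightarrow> C * (LINT \<tau>|lebesgue_on {0..t}. m \<tau>) \<le> 1"
    and l: "integrable (lebesgue_on {0..\<delta>}) l"
    and l_lip: "\<And>(u :: real \<Rightarrow> real^'m \<Rightarrow> real^'n) v e. (\<And>t x. t \<in> {0..\<delta>} \<Longrightarrow> x \<in> closure U \<Longrightarrow> norm (u t x) \<le> C * \<rho> + 1) \<Longrightarrow>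
      (\<And>t x. t \<in> {0..\<delta>} \<Longrightarrow> x \<in> closure U \<Longrightarrow> norm (v t x) \<le> C * \<rho> + 1) \<Longrightarrow>
      (\<And>t x. t \<in> {0..\<delta>} \<Longrightarrow> x \<in> closure U \<Longrightarrow> norm (u t x - v t x) \<le> e t) \<Longrightarrow>
      AE \<tau> in lebesgue_on {0..\<delta>}. \<forall>x\<in>closure U. norm (forcing u \<tau> x - forcing v \<tau> x) \<le> l \<tau> * e \<tau>"
    and l_small: "\<And>t. t \<in> {0..\<delta>} \<Longrightarrow> C * (LINT \<tau>|lebesgue_on {0..t}. l \<tau>) \<le> 1 / 2"
    and \<delta>: "0 \<le> \<delta>"
  obtains u where "solution z \<delta> u"
proof -
  define R where "R = C * \<rho> + 1"
  define A where "A = {0..\<delta>} \<times> closure U"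
  define B :: "(real \<Rightarrow> real^'m \<Rightarrow> real^'n) set" where "B = {u \<in> path_space \<kappa> U \<delta>. \<forall>t\<in>{0..\<delta>}. \<forall>x\<in>closure U. norm (u t x) \<le> R}"
  define \<Phi> where "\<Phi> u = (\<lambda>t\<in>{0..\<delta>}. \<lambda>x. S t z x + duhamel S (forcing u) t x)" for u
  define ev where "ev u = (\<lambda>(t, x). u t x)" for u :: "real \<Rightarrow> real^'m \<Rightarrow> real^'n"
  have dom: "dominated \<kappa> U {0..\<delta>} (forcing u) m" if "u \<in> B" for u
    using that m by (simp add: B_def R_def)
  have dom_t: "dominated \<kappa> U {0..t} (forcing u) m" if "u \<in> B" "t \<in> {0..\<delta>}" for u t
    using that by (intro dominated_subset[OF dom]) auto
  \<comment> \<open>This makes the radius nonnegative, so that the zero path lies in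
    \<open>B\<close> and can start the iteration.\<close>
  have "\<rho> \<ge> 0"
  proof -
    obtain x where "x \<in> closure U" using U(1) closure_subset by blast
    then show ?thesis using z_bound norm_ge_zero order_trans by blast
  qed
  then have R0: "R \<ge> 0" using C_pos by (simp add: R_def)
  obtain u where u: "u \<in> B" "\<And>p. p \<in> A \<Longrightarrow> ev (\<Phi> u) p = ev u p"
  proof (rule contraction_fixpoint[of "\<lambda>t\<in>{0..\<delta>}. \<lambda>x. 0" B \<Phi> A ev R])
    show "(\<lambda>t\<in>{0..\<delta>}. \<lambda>x. 0) \<in> B"
      using R0 unfolding B_def path_space_iff[OF U]
      by (auto intro!: continuous_on_eq[OF continuous_on_const[of _ 0]])
  next
    fix u assume u: "u \<in> B"
    have "norm (\<Phi> u t x) \<le> R" if "t \<in> {0..\<delta>}" "x \<in> closure U" for t x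
    proof -
      have "norm (S t z x) \<le> C * \<rho>" using that z z_bound by (intro S_bound) auto
      moreover have "norm (duhamel S (forcing u) t x) \<le> 1"
        using duhamel_bound[OF dom_t[OF u that(1)] that(2)] m_small[OF that(1)] by simp
      ultimately show ?thesis
        using that norm_triangle_ineq[of "S t z x" "duhamel S (forcing u) t x"]
        by (simp add: \<Phi>_def R_def)
    qed
    then show "\<Phi> u \<in> B"
      using mild_path[OF dom[OF u] z] by (simp add: B_def \<Phi>_def)
  next
    fix u v e p
    assume u: "u \<in> B" and v: "v \<in> B" and e: "\<And>p. p \<in> A \<Longrightarrow> norm (ev u p - ev v p) \<le> e" and p: "p \<in> A"
    obtain t x where p_eq: "p = (t, x)" and t: "t \<in> {0..\<delta>}" and x: "x \<in> closure U"
      using p by (auto simp: A_def)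
    have e0: "0 \<le> e" using e[OF p] norm_ge_zero order_trans by blast
    have "AE \<tau> in lebesgue_on {0..\<delta>}. \<forall>x\<in>closure U. norm (forcing u \<tau> x - forcing v \<tau> x) \<le> l \<tau> * e"
      using u v e by (intro l_lip) (auto simp: B_def R_def A_def ev_def)
    then have AE: "AE \<tau> in lebesgue_on {0..t}. \<forall>x\<in>closure U. norm (forcing u \<tau> x - forcing v \<tau> x) \<le> l \<tau> * e"
      by (rule AE_lebesgue_on_subset) (use t in auto)
    have l_t: "integrable (lebesgue_on {0..t}) l"
      by (rule integrable_lebesgue_on_subset[OF l]) (use t in auto)
    have "norm (ev (\<Phi> u) p - ev (\<Phi> v) p) = norm (duhamel S (forcing u) t x - duhamel S (forcing v) t x)"
      using t by (simp add: p_eq ev_def \<Phi>_def)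
    also have "\<dots> \<le> C * (LINT \<tau>|lebesgue_on {0..t}. l \<tau> * e)"
      by (rule duhamel_diff_bound[OF dom_t[OF u t] dom_t[OF v t] _ AE x]) (use l_t in simp)
    also have "\<dots> = C * (LINT \<tau>|lebesgue_on {0..t}. l \<tau>) * e" by simp
    also have "\<dots> \<le> 1 / 2 * e" by (intro mult_right_mono l_small t e0)
    finally show "norm (ev (\<Phi> u) p - ev (\<Phi> v) p) \<le> e / 2" by simp
  next
    fix u p assume "u \<in> B" "p \<in> A"
    then show "norm (ev u p) \<le> R" by (auto simp: A_def B_def ev_def)
  next
    fix w h assume w: "\<And>n::nat. w n \<in> B" and lim: "uniform_limit A (\<lambda>n. ev (w n)) h sequentially"
    \<comment> \<open>The limit is known only on \<open>A\<close>. It is extended by 0 in space and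
      by \<open>undefined\<close> in time, following the conventions of \<open>cont_space\<close>
      and \<open>path_space\<close>.\<close>
    define u where "u = (\<lambda>t\<in>{0..\<delta>}. \<lambda>x. if x \<in> closure U then h (t, x) else 0)"
    have pw: "(\<lambda>n. w n t x) \<longlonglongrightarrow> h (t, x)" if "t \<in> {0..\<delta>}" "x \<in> closure U" for t x
      using tendsto_uniform_limitI[OF lim, of "(t, x)"] that by (simp add: A_def ev_def)
    have wX: "w n t \<in> cont_space \<kappa> U" if "t \<in> {0..\<delta>}" for n t
      using w[of n] that by (auto simp: B_def path_space_def)
    have h_cont: "continuous_on A h"
    proof (rule uniform_limit_theorem[OF _ lim])
      show "\<forall>\<^sub>F n in sequentially. continuous_on A (ev (w n))"
        using w by (auto simp: B_def path_space_iff[OF U] A_def ev_def[abs_def])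
    qed simp
    have "u t \<in> cont_space \<kappa> U" if t: "t \<in> {0..\<delta>}" for t
    proof -
      have "continuous_on (closure U) (\<lambda>x. h (t, x))"
        by (rule continuous_on_compose2[OF h_cont]) (use t in \<open>auto simp: A_def intro!: continuous_intros\<close>)
      then have "continuous_on (closure U) (u t)"
        by (rule continuous_on_eq) (use t in \<open>simp add: u_def\<close>)
      moreover have "u t x = 0" if "\<kappa> = 0" "x \<in> frontier U" for x
      proof -
        have "x \<in> closure U" using that(2) by (simp add: frontier_def)
        moreover have "w n t x = 0" for n using wX[OF t, of n] that by (simp add: cont_space_def)
        ultimately show ?thesis
          using pw[OF t, of x] t by (simp add: u_def LIMSEQ_const_iff)
      qed
      ultimately show ?thesis using t by (simp add: cont_space_def) (simp add: u_def)
    qed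
    then have "u \<in> path_space \<kappa> U \<delta>"
      unfolding path_space_iff[OF U]
      by (auto simp: u_def A_def[symmetric] intro!: continuous_on_eq[OF h_cont]) (auto simp: A_def)
    moreover have "norm (u t x) \<le> R" if "t \<in> {0..\<delta>}" "x \<in> closure U" for t x
    proof -
      have "norm (h (t, x)) \<le> R"
        by (rule LIMSEQ_le_const2[OF tendsto_norm[OF pw[OF that]]])
          (use w that in \<open>auto simp: B_def\<close>)
      then show ?thesis using that by (simp add: u_def)
    qed
    ultimately have "u \<in> B" by (simp add: B_def)
    moreover have "\<forall>p\<in>A. ev u p = h p" by (auto simp: A_def ev_def u_def)
    ultimately show "\<exists>u\<in>B. \<forall>p\<in>A. ev u p = h p" by blast
  qed (rule that)
  have "\<Phi> u \<in> path_space \<kappa> U \<delta>" using mild_path[OF dom[OF u(1)] z] by (simp add: \<Phi>_def)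
  have "solution z \<delta> u"
    unfolding solution_def
  proof (intro conjI ballI ext)
    show path: "u \<in> path_space \<kappa> U \<delta>" using u(1) by (simp add: B_def)
    fix t x assume t: "t \<in> {0..\<delta>}"
    \<comment> \<open>The fixed point equation holds on \<open>A\<close>; outside
      \<open>closure U\<close> both sides are 0.\<close>
    have "u t x = \<Phi> u t x"
    proof (cases "x \<in> closure U")
      case True
      then show ?thesis using u(2)[of "(t, x)"] t by (simp add: A_def ev_def)
    next
      case False
      have "u t \<in> cont_space \<kappa> U" "\<Phi> u t \<in> cont_space \<kappa> U"
        using path \<open>\<Phi> u \<in> _\<close> t by (auto simp: path_space_def)
      then show ?thesis using False by (simp add: cont_space_def)
    qed
    then show "u t x = S t z x + duhamel S (forcing u) t x" using t by (simp add: \<Phi>_def)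
  qed
  then show thesis by (rule that)
qed

text \<open>If the solutions agree before \<open>a\<close>, any bound on their difference before
  \<open>a + \<eta>\<close> may be halved. Repetition drives the bound from \<open>2 * R\<close> to
  0, so agreement extends by \<open>\<eta>\<close>. As \<open>\<eta>\<close> does not depend on
  \<open>a\<close>, finitely many such steps reach every time.\<close>

lemma solution_unique:
  assumes u: "solution z \<delta> u" and v: "solution z \<delta> v"
  shows "u = v"
proof -
  have u_path: "u \<in> path_space \<kappa> U \<delta>" and v_path: "v \<in> path_space \<kappa> U \<delta>"
    using u v by (auto simp: solution_def)
  obtain Ru Rv where Ru: "\<forall>t\<in>{0..\<delta>}. \<forall>x\<in>closure U. norm (u t x) \<le> Ru"
    and Rv: "\<forall>t\<in>{0..\<delta>}. \<forall>x\<in>closure U. norm (v t x) \<le> Rv"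
    using path_space_bounded[OF U u_path] path_space_bounded[OF U v_path] by blast
  define R where "R = max Ru Rv"
  have R: "norm (u t x) \<le> R" "norm (v t x) \<le> R" if "t \<in> {0..\<delta>}" "x \<in> closure U" for t x
    using Ru Rv that by (auto simp: R_def intro: max.coboundedI1 max.coboundedI2)
  obtain mu where mu: "dominated \<kappa> U {0..\<delta>} (forcing u) mu"
    by (rule path_forcing_dominated[OF u_path])
  obtain mv where mv: "dominated \<kappa> U {0..\<delta>} (forcing v) mv"
    by (rule path_forcing_dominated[OF v_path])
  show ?thesis
  proof (rule forcing_lipschitz[of R])
    fix l
    assume l_int: "\<And>a b. integrable (lebesgue_on {a..b}) l"
      and lip: "\<And>\<delta> u v e. (\<And>t x. t \<in> {0..\<delta>} \<Longrightarrow> x \<in> closure U \<Longrightarrow> norm (u t x) \<le> R) \<Longrightarrow>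
        (\<And>t x. t \<in> {0..\<delta>} \<Longrightarrow> x \<in> closure U \<Longrightarrow> norm (v t x) \<le> R) \<Longrightarrow>
        (\<And>t x. t \<in> {0..\<delta>} \<Longrightarrow> x \<in> closure U \<Longrightarrow> norm (u t x - v t x) \<le> e t) \<Longrightarrow>
        AE \<tau> in lebesgue_on {0..\<delta>}. \<forall>x\<in>closure U. norm (forcing u \<tau> x - forcing v \<tau> x) \<le> l \<tau> * e \<tau>"
    have "0 < 1 / (2 * C)" using C_pos by simp
    then obtain \<eta> where \<eta>: "0 < \<eta>" "\<And>a b. 0 \<le> a \<Longrightarrow> a \<le> b \<Longrightarrow> b \<le> \<delta> \<Longrightarrow> b - a \<le> \<eta> \<Longrightarrow>
        (LINT \<tau>|lebesgue_on {a..b}. l \<tau>) < 1 / (2 * C)"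
      using small_integrals[OF l_int] by blast
    \<comment> \<open>The forcing difference vanishes before \<open>a\<close>, so only the integral
      of \<open>l\<close> over \<open>{a..t}\<close> counts; the threshold
      \<open>1 / (2 * C)\<close> absorbs the bound of the semigroup.\<close>
    have half: "norm (u t x - v t x) \<le> e / 2"
      if a: "0 \<le> a" "\<And>t x. t \<in> {0..\<delta>} \<Longrightarrow> t < a \<Longrightarrow> x \<in> closure U \<Longrightarrow> u t x = v t x"
        and e: "0 \<le> e" "\<And>t x. t \<in> {0..\<delta>} \<Longrightarrow> t < a + \<eta> \<Longrightarrow> x \<in> closure U \<Longrightarrow> norm (u t x - v t x) \<le> e"
        and t: "t \<in> {0..\<delta>}" "t < a + \<eta>" and x: "x \<in> closure U" for a e t x
    proof (cases "t < a")
      case True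
      then show ?thesis using a(2)[OF t(1) True x] e(1) by simp
    next
      case False
      define m where "m = (\<lambda>\<tau>. if \<tau> \<in> {a..t} then l \<tau> * e else 0)"
      have sub: "{a..t} \<subseteq> {0..t}" using a(1) by auto
      have m_int: "integrable (lebesgue_on {0..t}) m"
        unfolding m_def by (subst integrable_lebesgue_on_if[OF sub]) (use l_int in auto)
      have "AE \<tau> in lebesgue_on {0..t}. \<forall>x\<in>closure U.
          norm (forcing u \<tau> x - forcing v \<tau> x) \<le> l \<tau> * (if \<tau> < a then 0 else e)"
        using a(2) e t R by (intro lip) (auto split: if_splits)
      then have AE: "AE \<tau> in lebesgue_on {0..t}. \<forall>x\<in>closure U. norm (forcing u \<tau> x - forcing v \<tau> x) \<le> m \<tau>"
        using AE_space by eventually_elim (auto simp: m_def split: if_splits)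
      have "norm (u t x - v t x) = norm (duhamel S (forcing u) t x - duhamel S (forcing v) t x)"
        using u v t(1) by (simp add: solution_def)
      also have "\<dots> \<le> C * (LINT \<tau>|lebesgue_on {0..t}. m \<tau>)"
        using t(1) by (intro duhamel_diff_bound[OF dominated_subset[OF mu] dominated_subset[OF mv] m_int AE x]) auto
      also have "(LINT \<tau>|lebesgue_on {0..t}. m \<tau>) = (LINT \<tau>|lebesgue_on {a..t}. l \<tau> * e)"
        unfolding m_def by (rule integral_lebesgue_on_if[OF sub]) auto
      also have "\<dots> = (LINT \<tau>|lebesgue_on {a..t}. l \<tau>) * e" by simp
      also have "C * \<dots> \<le> C * (1 / (2 * C) * e)"
        using a(1) t False e(1) C_pos by (intro mult_left_mono mult_right_mono less_imp_le[OF \<eta>(2)]) auto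
      also have "\<dots> = e / 2" using C_pos by simp
      finally show ?thesis .
    qed
    \<comment> \<open>With the strict inequality the case \<open>k = 0\<close> is empty, since no
      time of the interval is negative.\<close>
    have eq: "u t x = v t x" if "t \<in> {0..\<delta>}" "t < real k * \<eta>" "x \<in> closure U" for k t x
      using that
    proof (induction k arbitrary: t x)
      case 0
      then show ?case by simp
    next
      case (Suc k)
      note eq_before = Suc.IH
      have k\<eta>: "0 \<le> real k * \<eta>" using \<eta>(1) by simp
      have R0: "0 \<le> R" using R(1)[OF Suc.prems(1,3)] norm_ge_zero order_trans by blast
      \<comment> \<open>The inner induction runs over the number of halvings, on the window reached
        by the outer one.\<close>
      have "norm (u s y - v s y) \<le> 2 * R / 2 ^ j"
        if "s \<in> {0..\<delta>}" "s < real k * \<eta> + \<eta>" "y \<in> closure U" for j s y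
        using that
      proof (induction j arbitrary: s y)
        case 0
        then have "norm (u s y - v s y) \<le> R + R"
          by (intro order_trans[OF norm_triangle_ineq4] add_mono R) auto
        then show ?case by simp
      next
        case (Suc j)
        have "norm (u s y - v s y) \<le> 2 * R / 2 ^ j / 2"
          by (rule half[OF k\<eta> _ _ _ Suc.prems]) (use R0 Suc.IH eq_before in auto)
        then show ?case by simp
      qed
      then have le: "norm (u t x - v t x) \<le> 2 * R * (1 / 2) ^ j" for j
        using Suc.prems by (simp add: algebra_simps power_one_over)
      have "(\<lambda>j. 2 * R * (1 / 2) ^ j) \<longlonglongrightarrow> 2 * R * 0"
        by (intro tendsto_intros LIMSEQ_power_zero) simp
      then have "norm (u t x - v t x) \<le> 2 * R * 0"
        by (rule LIMSEQ_le_const) (use le in auto)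
      then show ?case by simp
    qed
    have "u t = v t" if t: "t \<in> {0..\<delta>}" for t
    proof
      fix x
      obtain k where k: "t < real k * \<eta>" using reals_Archimedean3[OF \<eta>(1)] by blast
      have "u t \<in> cont_space \<kappa> U" "v t \<in> cont_space \<kappa> U"
        using u_path v_path t by (auto simp: path_space_def)
      then show "u t x = v t x" using eq[OF t k] by (cases "x \<in> closure U") (auto simp: cont_space_def)
    qed
    moreover have "u \<in> {0..\<delta>} \<rightarrow>\<^sub>E cont_space \<kappa> U" "v \<in> {0..\<delta>} \<rightarrow>\<^sub>E cont_space \<kappa> U"
      using u_path v_path by (simp_all add: path_space_def)
    ultimately show "u = v" by (rule PiE_ext[rotated -1])
  qed
qed

text \<open>The order of choices matters: \<open>r\<close> and \<open>z0\<close> determine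
  \<open>\<rho>\<close>, this fixes \<open>m\<close> and \<open>l\<close>, these fix
  \<open>\<delta>\<close>, and only then is \<open>z\<close> given. The radius \<open>r\<close> is
  arbitrary.\<close>

lemma local_wellposedness:
  assumes z0: "z0 \<in> cont_space \<kappa> U"
  shows "\<exists>\<delta>>0. \<forall>z\<in>cont_space \<kappa> U. (\<forall>x\<in>closure U. norm (z x - z0 x) \<le> r) \<longrightarrow> (\<exists>!u. solution z \<delta> u)"
proof -
  define \<rho> where "\<rho> = X_norm U z0 + r"
  show ?thesis
  proof (rule forcing_dominated[of "C * \<rho> + 1"], rule forcing_lipschitz[of "C * \<rho> + 1"])
    fix m l
    assume m_int: "\<And>a b. integrable (lebesgue_on {a..b}) m" and l_int: "\<And>a b. integrable (lebesgue_on {a..b}) l"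
      and m: "\<And>\<delta> u. u \<in> path_space \<kappa> U \<delta> \<Longrightarrow>
        (\<And>t x. t \<in> {0..\<delta>} \<Longrightarrow> x \<in> closure U \<Longrightarrow> norm (u t x) \<le> C * \<rho> + 1) \<Longrightarrow>
        dominated \<kappa> U {0..\<delta>} (forcing u) m"
      and l: "\<And>\<delta> u v e. (\<And>t x. t \<in> {0..\<delta>} \<Longrightarrow> x \<in> closure U \<Longrightarrow> norm (u t x) \<le> C * \<rho> + 1) \<Longrightarrow>
        (\<And>t x. t \<in> {0..\<delta>} \<Longrightarrow> x \<in> closure U \<Longrightarrow> norm (v t x) \<le> C * \<rho> + 1) \<Longrightarrow>
        (\<And>t x. t \<in> {0..\<delta>} \<Longrightarrow> x \<in> closure U \<Longrightarrow> norm (u t x - v t x) \<le> e t) \<Longrightarrow>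
        AE \<tau> in lebesgue_on {0..\<delta>}. \<forall>x\<in>closure U. norm (forcing u \<tau> x - forcing v \<tau> x) \<le> l \<tau> * e \<tau>"
    have C: "0 < 1 / C" "0 < 1 / (2 * C)" using C_pos by auto
    obtain \<eta>1 where \<eta>1: "0 < \<eta>1" "\<And>a b. 0 \<le> a \<Longrightarrow> a \<le> b \<Longrightarrow> b \<le> 1 \<Longrightarrow> b - a \<le> \<eta>1 \<Longrightarrow>
        (LINT \<tau>|lebesgue_on {a..b}. m \<tau>) < 1 / C"
      using small_integrals[OF m_int C(1)] by blast
    obtain \<eta>2 where \<eta>2: "0 < \<eta>2" "\<And>a b. 0 \<le> a \<Longrightarrow> a \<le> b \<Longrightarrow> b \<le> 1 \<Longrightarrow> b - a \<le> \<eta>2 \<Longrightarrow>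
        (LINT \<tau>|lebesgue_on {a..b}. l \<tau>) < 1 / (2 * C)"
      using small_integrals[OF l_int C(2)] by blast
    \<comment> \<open>The cap 1 keeps the interval inside \<open>{0..1}\<close>, where both
      smallness statements were obtained.\<close>
    define \<delta> where "\<delta> = min 1 (min \<eta>1 \<eta>2)"
    have \<delta>: "0 < \<delta>" using \<eta>1(1) \<eta>2(1) by (simp add: \<delta>_def)
    have m_small: "C * (LINT \<tau>|lebesgue_on {0..t}. m \<tau>) \<le> 1" if "t \<in> {0..\<delta>}" for t
      using \<eta>1(2)[of 0 t] that C_pos by (simp add: \<delta>_def field_simps less_imp_le)
    have l_small: "C * (LINT \<tau>|lebesgue_on {0..t}. l \<tau>) \<le> 1 / 2" if "t \<in> {0..\<delta>}" for t
      using \<eta>2(2)[of 0 t] that C_pos by (simp add: \<delta>_def field_simps less_imp_le)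
    have "\<exists>!u. solution z \<delta> u"
      if z: "z \<in> cont_space \<kappa> U" and near: "\<forall>x\<in>closure U. norm (z x - z0 x) \<le> r" for z
    proof -
      have z_bound: "norm (z x) \<le> \<rho>" if x: "x \<in> closure U" for x
        using norm_triangle_ineq[of "z0 x" "z x - z0 x"] near x norm_le_X_norm[OF U(2) z0 x]
        by (fastforce simp: \<rho>_def)
      obtain u where "solution z \<delta> u"
        by (rule local_existence[OF z z_bound m m_small l_int l l_small less_imp_le[OF \<delta>]])
      then show ?thesis using solution_unique by blast
    qed
    then show ?thesis using \<delta> by blast
  qed
qed

section \<open>Return to mild solutions\<close>

lemma duhamel_0: "duhamel S g 0 x = 0"
  unfolding duhamel_def by (intro integral_eq_zero_null_sets) simp

lemma solution_0:
  assumes "solution z \<delta> u" "z \<in> cont_space \<kappa> U" "0 \<le> \<delta>"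
  shows "u 0 = z"
  using assms by (simp add: solution_def S_zero duhamel_0)

end

text \<open>Every witness \<open>I\<close> of a mild solution equals the pointwise integral, because
  evaluations determine the Bochner integral. Conversely, domination of the forcing along a path
  makes the pointwise integral a Bochner integral, and \<open>u 0 = z\<close> follows since the
  integral over a single time vanishes.\<close>

lemma mild_solution_iff:
  assumes P: "semilinear_problem \<kappa> U (product_semigroup T) C f"
    and z: "z \<in> cont_space \<kappa> U" and \<delta>: "0 \<le> \<delta>"
  shows "mild_solution \<kappa> U T f z \<delta> u \<longleftrightarrow> semilinear_problem.solution \<kappa> U (product_semigroup T) f z \<delta> u"
proof -
  interpret semilinear_problem \<kappa> U "product_semigroup T" C f by (rule P)
  show ?thesis
  proof
    assume u: "mild_solution \<kappa> U T f z \<delta> u"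
    show "solution z \<delta> u"
      unfolding solution_def
    proof (intro conjI ballI)
      show "u \<in> path_space \<kappa> U \<delta>" using u by (simp add: mild_solution_def)
      fix t assume "t \<in> {0..\<delta>}"
      with u obtain I where I: "has_X_integral \<kappa> U {0..t} (\<lambda>s. product_semigroup T (t - s) (forcing u s)) I"
        and ut: "u t = (\<lambda>x. product_semigroup T t z x + I x)"
        unfolding mild_solution_def by blast
      show "u t = (\<lambda>x. product_semigroup T t z x + duhamel (product_semigroup T) (forcing u) t x)"
        unfolding ut duhamel_def by (simp add: has_X_integral_pointwise[OF U _ I])
    qed
  next
    assume u: "solution z \<delta> u"
    then have path: "u \<in> path_space \<kappa> U \<delta>" by (simp add: solution_def)
    obtain m where m: "dominated \<kappa> U {0..\<delta>} (forcing u) m" by (rule path_forcing_dominated[OF path])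
    have "has_X_integral \<kappa> U {0..t} (\<lambda>s. product_semigroup T (t - s) (forcing u s))
        (duhamel (product_semigroup T) (forcing u) t)" if "t \<in> {0..\<delta>}" for t
      using that by (intro has_X_integral_duhamel[OF dominated_subset[OF m]]) auto
    then show "mild_solution \<kappa> U T f z \<delta> u"
      using u path solution_0[OF u z \<delta>] unfolding mild_solution_def solution_def by blast
  qed
qed

theorem theorem2p9:
  fixes U :: "(real^'m) set"
    and \<kappa> :: real
    and \<alpha> :: "'n::finite \<Rightarrow> real^'m \<Rightarrow> real"
    and T :: "'n \<Rightarrow> real \<Rightarrow> (real^'m \<Rightarrow> real) \<Rightarrow> (real^'m \<Rightarrow> real)"
    and f :: "real \<Rightarrow> real^'m \<Rightarrow> real^'n \<Rightarrow> real^'n"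
    and z0 :: "real^'m \<Rightarrow> real^'n"
  assumes "U \<noteq> {}" "bounded U" "open U" "connected U" "C1_boundary U"
    and "boundary_coefficients U \<kappa> \<alpha>"
    and "\<And>i. laplace_semigroup \<kappa> U (\<alpha> i) (T i)"
    and "lipschitz_caratheodory U f"
    and "\<kappa> = 0 \<Longrightarrow> (\<forall>t. \<forall>x\<in>frontier U. f t x 0 = 0)"
    and "z0 \<in> cont_space \<kappa> U"
  shows "\<exists>r>0. \<exists>\<delta>>0. \<forall>z\<in>cont_space \<kappa> U. X_norm U (\<lambda>x. z x - z0 x) \<le> r \<longrightarrow>
    (\<exists>!u. mild_solution \<kappa> U T f z \<delta> u)"
proof -
  interpret bounded_evolution \<kappa> U "product_semigroup T" "real CARD('n)"
  proof (rule bounded_evolution_product_semigroup)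
    show "C0_semigroup \<kappa> U (T i)" for i
      using assms(7)[of i] by (simp add: laplace_semigroup_def)
    show "sup_norm U (T i t z) \<le> sup_norm U z" if "0 \<le> t" "z \<in> cont_space \<kappa> U" for i t z
      using assms(7)[of i] that by (simp add: laplace_semigroup_def)
  qed (use assms in auto)
  interpret semilinear_problem \<kappa> U "product_semigroup T" "real CARD('n)" f
    by unfold_locales (use assms in auto)
  \<comment> \<open>The radius 1 is an arbitrary choice. A ball for \<open>X_norm\<close> lies in
    the pointwise Euclidean ball of the same radius.\<close>
  obtain \<delta> where \<delta>: "0 < \<delta>" "\<And>z. z \<in> cont_space \<kappa> U \<Longrightarrow> \<forall>x\<in>closure U. norm (z x - z0 x) \<le> 1 \<Longrightarrow>
      \<exists>!u. solution z \<delta> u"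
    using local_wellposedness[OF assms(10), of 1] by blast
  have "\<exists>!u. mild_solution \<kappa> U T f z \<delta> u"
    if z: "z \<in> cont_space \<kappa> U" and "X_norm U (\<lambda>x. z x - z0 x) \<le> 1" for z
  proof -
    have "norm (z x - z0 x) \<le> 1" if "x \<in> closure U" for x
      using norm_le_X_norm[OF U(2) cont_space_diff[OF z assms(10)] that] \<open>X_norm U _ \<le> 1\<close> by simp
    then show ?thesis
      using \<delta> z mild_solution_iff[OF semilinear_problem_axioms z] by simp
  qed
  then show ?thesis by (intro exI[of _ 1] exI[of _ \<delta>] conjI ballI impI zero_less_one \<delta>(1))
qed

end
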